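(* Let $L=\|K\|$, let $\beta>0$ and $\tau,\sigma>0$ satisfy $\tau L_f+\sigma\tau L^2+\tau\beta L<1$, let $i\in\{1,2,3\}$, and let $(x^n,y^n)_{n\ge 0}$ be generated from $(x^0,y^0)\in\mathcal X\times\mathcal Y$, with $x^{-1}=x^0$, by $$y^{n+1}\approx_2^{\delta_{n+1}}\mathrm{prox}_{\sigma h^*}\big(y^n+\sigma K(2x^n-x^{n-1})\big),\qquad x^{n+1}\approx_i^{\varepsilon_{n+1}}\mathrm{prox}_{\tau g}\big(x^n-\tau(K^*y^{n+1}+\nabla f(x^n)+e^{n+1})\big),$$ for all $n\ge0$, where $\varepsilon_n,\delta_n\ge0$ and $e^n\in\mathcal X$ $(n\ge 1)$ are given errors. Put $X^N:=\frac1N\sum_{n=1}^Nx^n$, $Y^N:=\frac1N\sum_{n=1}^Ny^n$. Let $\alpha>0$ and assume $$\|e^n\|=O\big(n^{-(\alpha+\frac12)}\big),\qquad\delta_n=O\big(n^{-2\alpha}\big),\qquad\varepsilon_n=\begin{cases}O\big(n^{-(2\alpha+1)}\big)&\text{if } i\in\{1,3\},\\O\big(n^{-2\alpha}\big)&\text{if } i=2.\end{cases}$$ Then for every saddle point $(x^\star,y^\star)$ of $\mathcal L$, as $N\to\infty$, $$\mathcal L(X^N,y^\star)-\mathcal L(x^\star,Y^N)=\begin{cases}O(N^{-1})&\text{if }\alpha>1/2,\\O(\ln^2(N)/N)&\text{if }\alpha=1/2,\\O(N^{-2\alpha})&\text{if }\alpha\in(0,\tfrac12).\end{cases}$$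
   Context: $\mathcal X,\mathcal Y$ are real Hilbert spaces and $\bar{\mathbb R}=\mathbb R\cup\{+\infty\}$. $K:\mathcal X\to\mathcal Y$ is a bounded linear operator; $f:\mathcal X\to\bar{\mathbb R}$ is proper, convex, lower semicontinuous and differentiable with $\|\nabla f(x)-\nabla f(x')\|\le L_f\|x-x'\|$ for all $x,x'\in\mathrm{dom} f$; $g:\mathcal X\to\bar{\mathbb R}$ and $h:\mathcal Y\to\bar{\mathbb R}$ are proper, convex, lower semicontinuous; $h^*$ is the convex conjugate of $h$. Put $$\mathcal L(x,y)=\langle Kx,y\rangle+f(x)+g(x)-h^*(y).$$ A saddle point is a pair $(x^\star,y^\star)$ with $\mathcal L(x^\star,y)\le\mathcal L(x^\star,y^\star)\le\mathcal L(x,y^\star)$ for all $(x,y)\in\mathcal X\times\mathcal Y$; at least one is assumed to exist. Inexact proximal points. For a proper, convex, lower semicontinuous $\varphi:\mathcal H\to\bar{\mathbb R}$ on a Hilbert space $\mathcal H$, $\lambda>0$ and $v\in\mathcal H$, let $\mathrm{prox}_{\lambda\varphi}(v)=\arg\min_{u}\{\frac1{2\lambda}\|u-v\|^2+\varphi(u)\}$ and $\Phi_\lambda(u)=\frac1{2\lambda}\|u-v\|^2+\varphi(u)$. For $\varepsilon\ge0$, $\partial_\varepsilon\varphi(z)=\{p:\varphi(u)\ge\varphi(z)+\langle p,u-z\rangle-\varepsilon\ \forall u\}$. Then - $z\approx_1^{\varepsilon}\mathrm{prox}_{\lambda\varphi}(v)$ means $0\in\partial_\varepsilon\Phi_\lambda(z)$;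 - $z\approx_2^{\varepsilon}\mathrm{prox}_{\lambda\varphi}(v)$ means $(v-z)/\lambda\in\partial_\varepsilon\varphi(z)$; - $z\approx_3^{\varepsilon}\mathrm{prox}_{\lambda\varphi}(v)$ means there is $r\in\mathcal H$ with $\|r\|\le\sqrt{2\lambda\varepsilon}$ and $z=\mathrm{prox}_{\lambda\varphi}(v+r)$. *)

theory Defs
  imports "HOL-Analysis.Analysis" "HOL-Library.Landau_Symbols"
begin

section \<open>Convex analysis with values in the extended reals\<close>

text \<open>Functions into the real line extended by \<open>+\<infinity>\<close> are functions into \<^typ>\<open>ereal\<close>;
  the value \<open>-\<infinity>\<close> is excluded by properness.\<close>

definition proper_fun :: "('a \<Rightarrow> ereal) \<Rightarrow> bool" where
  "proper_fun \<phi> \<longleftrightarrow> (\<forall>x. \<phi> x \<noteq> -\<infinity>) \<and> (\<exists>x. \<phi> x \<noteq> \<infinity>)"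

definition edom :: "('a \<Rightarrow> ereal) \<Rightarrow> 'a set" where
  "edom \<phi> = {x. \<phi> x < \<infinity>}"

text \<open>The endpoints \<open>t = 0\<close> and \<open>t = 1\<close> carry no information; leaving them out avoids the
  product \<open>0 * \<infinity>\<close>.\<close>

definition convex_fun :: "('a::real_vector \<Rightarrow> ereal) \<Rightarrow> bool" where
  "convex_fun \<phi> \<longleftrightarrow> (\<forall>x y t. 0 < t \<and> t < 1 \<longrightarrow>
     \<phi> ((1 - t) *\<^sub>R x + t *\<^sub>R y) \<le> ereal (1 - t) * \<phi> x + ereal t * \<phi> y)"

definition lsc_fun :: "('a::topological_space \<Rightarrow> ereal) \<Rightarrow> bool" where
  "lsc_fun \<phi> \<longleftrightarrow> (\<forall>x. \<phi> x \<le> Liminf (at x) \<phi>)"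

definition pcl_fun :: "('a::real_normed_vector \<Rightarrow> ereal) \<Rightarrow> bool" where
  "pcl_fun \<phi> \<longleftrightarrow> proper_fun \<phi> \<and> convex_fun \<phi> \<and> lsc_fun \<phi>"

definition conjugate :: "('a::real_inner \<Rightarrow> ereal) \<Rightarrow> 'a \<Rightarrow> ereal" where
  "conjugate \<phi> y = (SUP x. ereal (x \<bullet> y) - \<phi> x)"

text \<open>Frechet differentiability of an extended-real function. The interior condition makes
  \<open>\<phi>\<close> finite near \<open>x\<close>, so that \<^const>\<open>real_of_ereal\<close>, which sends
  \<open>\<infinity>\<close> to \<open>0\<close>, does not affect the derivative.\<close>

definition ediff_at :: "('a::real_inner \<Rightarrow> ereal) \<Rightarrow> 'a \<Rightarrow> bool" where
  "ediff_at \<phi> x \<longleftrightarrow>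
     x \<in> interior (edom \<phi>) \<and> (\<lambda>u. real_of_ereal (\<phi> u)) differentiable (at x)"

definition grad :: "('a::real_inner \<Rightarrow> ereal) \<Rightarrow> 'a \<Rightarrow> 'a" where
  "grad \<phi> x = (THE d. GDERIV (\<lambda>u. real_of_ereal (\<phi> u)) x :> d)"

definition eps_subdiff :: "real \<Rightarrow> ('a::real_inner \<Rightarrow> ereal) \<Rightarrow> 'a \<Rightarrow> 'a set" where
  "eps_subdiff \<epsilon> \<phi> z = {p. \<forall>u. \<phi> u \<ge> \<phi> z + ereal (p \<bullet> (u - z)) - ereal \<epsilon>}"


section \<open>Inexact proximal points\<close>

definition prox_obj :: "real \<Rightarrow> ('a::real_inner \<Rightarrow> ereal) \<Rightarrow> 'a \<Rightarrow> 'a \<Rightarrow> ereal" where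
  "prox_obj lam \<phi> v u = ereal (1 / (2 * lam) * (norm (u - v))\<^sup>2) + \<phi> u"

text \<open>\<open>is_prox lam \<phi> v z\<close> says that \<open>z\<close> is the minimiser of the proximal objective, which is
  unique for \<open>lam > 0\<close> and proper convex lower semicontinuous \<open>\<phi>\<close>.\<close>

definition is_prox :: "real \<Rightarrow> ('a::real_inner \<Rightarrow> ereal) \<Rightarrow> 'a \<Rightarrow> 'a \<Rightarrow> bool" where
  "is_prox lam \<phi> v z \<longleftrightarrow> is_arg_min (prox_obj lam \<phi> v) (\<lambda>_. True) z"

definition approx_prox1 :: "real \<Rightarrow> real \<Rightarrow> ('a::real_inner \<Rightarrow> ereal) \<Rightarrow> 'a \<Rightarrow> 'a \<Rightarrow> bool" where
  "approx_prox1 \<epsilon> lam \<phi> v z \<longleftrightarrow> 0 \<in> eps_subdiff \<epsilon> (prox_obj lam \<phi> v) z"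

definition approx_prox2 :: "real \<Rightarrow> real \<Rightarrow> ('a::real_inner \<Rightarrow> ereal) \<Rightarrow> 'a \<Rightarrow> 'a \<Rightarrow> bool" where
  "approx_prox2 \<epsilon> lam \<phi> v z \<longleftrightarrow> (v - z) /\<^sub>R lam \<in> eps_subdiff \<epsilon> \<phi> z"

definition approx_prox3 :: "real \<Rightarrow> real \<Rightarrow> ('a::real_inner \<Rightarrow> ereal) \<Rightarrow> 'a \<Rightarrow> 'a \<Rightarrow> bool" where
  "approx_prox3 \<epsilon> lam \<phi> v z \<longleftrightarrow>
     (\<exists>r. norm r \<le> sqrt (2 * lam * \<epsilon>) \<and> is_prox lam \<phi> (v + r) z)"

definition approx_prox ::
    "nat \<Rightarrow> real \<Rightarrow> real \<Rightarrow> ('a::real_inner \<Rightarrow> ereal) \<Rightarrow> 'a \<Rightarrow> 'a \<Rightarrow> bool" where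
  "approx_prox i \<epsilon> lam \<phi> v z \<longleftrightarrow>
     (i = 1 \<and> approx_prox1 \<epsilon> lam \<phi> v z) \<or>
     (i = 2 \<and> approx_prox2 \<epsilon> lam \<phi> v z) \<or>
     (i = 3 \<and> approx_prox3 \<epsilon> lam \<phi> v z)"


section \<open>The saddle-point problem and the inexact primal-dual iteration\<close>

text \<open>\<open>\<infinity> - \<infinity>\<close> equals \<open>\<infinity>\<close> in \<^typ>\<open>ereal\<close>. This convention does not influence which
  points are saddle points: if \<open>f + g\<close> and \<open>h\<^sup>*\<close> are proper, the value at a
  saddle point is finite whatever value is assigned to \<open>\<infinity> - \<infinity>\<close>.\<close>

definition Lagr ::
    "('a::real_inner \<Rightarrow> 'b::real_inner) \<Rightarrow> ('a \<Rightarrow> ereal) \<Rightarrow> ('a \<Rightarrow> ereal) \<Rightarrow> ('b \<Rightarrow> ereal)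
      \<Rightarrow> 'a \<Rightarrow> 'b \<Rightarrow> ereal" where
  "Lagr K f g h x y = ereal (K x \<bullet> y) + f x + g x - conjugate h y"

definition saddle_point ::
    "('a::real_inner \<Rightarrow> 'b::real_inner) \<Rightarrow> ('a \<Rightarrow> ereal) \<Rightarrow> ('a \<Rightarrow> ereal) \<Rightarrow> ('b \<Rightarrow> ereal)
      \<Rightarrow> 'a \<Rightarrow> 'b \<Rightarrow> bool" where
  "saddle_point K f g h xs ys \<longleftrightarrow>
     (\<forall>x y. Lagr K f g h xs y \<le> Lagr K f g h xs ys \<and>
            Lagr K f g h xs ys \<le> Lagr K f g h x ys)"

text \<open>The convention \<open>x\<^sup>-\<^sup>1 = x\<^sup>0\<close> is encoded by truncated subtraction: \<open>x (0 - 1) = x 0\<close>.\<close>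

definition inexact_pd_iteration ::
    "('a::real_inner \<Rightarrow> 'b::real_inner) \<Rightarrow> ('a \<Rightarrow> ereal) \<Rightarrow> ('a \<Rightarrow> ereal) \<Rightarrow> ('b \<Rightarrow> ereal)
      \<Rightarrow> real \<Rightarrow> real \<Rightarrow> nat \<Rightarrow> (nat \<Rightarrow> real) \<Rightarrow> (nat \<Rightarrow> real) \<Rightarrow> (nat \<Rightarrow> 'a)
      \<Rightarrow> (nat \<Rightarrow> 'a) \<Rightarrow> (nat \<Rightarrow> 'b) \<Rightarrow> bool" where
  "inexact_pd_iteration K f g h \<tau> \<sigma> i \<epsilon> \<delta> e x y \<longleftrightarrow>
     (\<forall>n. approx_prox2 (\<delta> (n + 1)) \<sigma> (conjugate h)
             (y n + \<sigma> *\<^sub>R K (2 *\<^sub>R x n - x (n - 1))) (y (n + 1)) \<and>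
          approx_prox i (\<epsilon> (n + 1)) \<tau> g
             (x n - \<tau> *\<^sub>R (adjoint K (y (n + 1)) + grad f (x n) + e (n + 1))) (x (n + 1)))"

definition ergodic_mean :: "(nat \<Rightarrow> 'a::real_vector) \<Rightarrow> nat \<Rightarrow> 'a" where
  "ergodic_mean x N = (1 / real N) *\<^sub>R (\<Sum>n = 1..N. x n)"

end

theory Submission
  imports Defs
begin

text \<open>
  One step of the iteration decreases the energy \<open>pd_energy\<close> by at least the primal-dual gap at the new
  iterate, up to the error \<open>E\<^sub>n * norm (x\<^sub>n - x\<^sup>\<star>) + \<epsilon>\<^sub>n + \<delta>\<^sub>n\<close>. Here \<open>E\<^sub>n\<close> is the norm of the gradient error plus,
  for inexact proximal points of type 1 and 3, \<open>sqrt (2 * \<epsilon>\<^sub>n / \<tau>)\<close>: such points satisfy the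
  subgradient inequality at every fixed point \<open>u\<close> up to an error of that size times the distance
  to \<open>u\<close>. The gaps at the iterates are nonnegative and the energy dominates
  \<open>(norm (x\<^sub>N - x\<^sup>\<star>))\<^sup>2 / (2 * \<tau>)\<close>, so the distances to the saddle point satisfy a quadratic
  inequality, which bounds the summed gaps by a constant times
  \<open>1 + (\<Sum>n\<le>N. \<epsilon>\<^sub>n + \<delta>\<^sub>n) + (\<Sum>n\<le>N. E\<^sub>n)\<^sup>2\<close>. Jensen's inequality transfers this to \<open>N\<close> times
  the gap at the ergodic means.

  Properness of the conjugate of \<open>h\<close>, the gradient of \<open>f\<close> and the adjoint of \<open>K\<close> all rest on
  projections onto closed convex sets of a Hilbert space.
\<close>

section \<open>Hilbert spaces\<close>

text \<open>By the parallelogram law a minimising sequence for the distance to \<open>a\<close> is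
  Cauchy; completeness yields its limit, the nearest point of \<open>S\<close>.\<close>

lemma ex_projection_closed_convex:
  fixes S :: "'a::{real_inner,complete_space} set"
  assumes "convex S" "closed S" "S \<noteq> {}"
  obtains p where "p \<in> S" "\<And>q. q \<in> S \<Longrightarrow> (a - p) \<bullet> (q - p) \<le> 0"
proof -
  define d where "d = infdist a S"
  have d0: "0 \<le> d" by (simp add: d_def infdist_nonneg)
  have d_le: "d \<le> norm (a - q)" if "q \<in> S" for q
    using infdist_le[OF that, of a] by (simp add: d_def dist_norm)
  have "\<exists>q\<in>S. norm (a - q) < d + 1 / real (Suc n)" for n
  proof -
    have "(INF q\<in>S. dist a q) < d + 1 / real (Suc n)"
      using \<open>S \<noteq> {}\<close> by (simp add: d_def infdist_notempty)
    then show ?thesis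
      using \<open>S \<noteq> {}\<close> bdd_below.I2[of S 0 "dist a"]
      by (subst (asm) cINF_less_iff) (auto simp: dist_norm)
  qed
  then obtain q where q: "\<And>n. q n \<in> S" "\<And>n. norm (a - q n) < d + 1 / real (Suc n)"
    by metis
  define c where "c n = (norm (a - q n))\<^sup>2 - d\<^sup>2" for n
  have lim_norm: "(\<lambda>n. norm (a - q n)) \<longlonglongrightarrow> d"
  proof (rule real_tendsto_sandwich[where f = "\<lambda>_. d" and h = "\<lambda>n. d + 1 / real (Suc n)"])
    show "(\<lambda>n. d + 1 / real (Suc n)) \<longlonglongrightarrow> d"
      using tendsto_add[OF tendsto_const LIMSEQ_inverse_real_of_nat, of d]
      by (simp add: inverse_eq_divide)
  qed (use d_le q in \<open>auto intro!: always_eventually less_imp_le\<close>)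
  then have c: "c \<longlonglongrightarrow> 0"
    unfolding c_def using tendsto_diff[OF tendsto_power[OF lim_norm, of 2] tendsto_const[of "d\<^sup>2"]]
    by simp
  \<comment> \<open>The midpoint of \<open>q m\<close> and \<open>q n\<close> lies in
    \<open>S\<close>, hence at distance at least \<open>d\<close> from \<open>a\<close>; the
    parallelogram identity does the rest.\<close>
  have par: "(norm (q m - q n))\<^sup>2 \<le> 2 * c m + 2 * c n" for m n
  proof -
    have "(1/2) *\<^sub>R q m + (1/2) *\<^sub>R q n \<in> S"
      using q(1) by (intro convexD[OF \<open>convex S\<close>]) auto
    then have "d\<^sup>2 \<le> (norm (a - ((1/2) *\<^sub>R q m + (1/2) *\<^sub>R q n)))\<^sup>2"
      using d_le d0 by (intro power_mono) auto
    then show ?thesis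
      unfolding c_def power2_norm_eq_inner
      by (simp add: inner_simps inner_commute algebra_simps)
  qed
  have "Cauchy q"
  proof (rule CauchyI)
    fix r :: real assume "0 < r"
    then have "eventually (\<lambda>n. c n < r\<^sup>2 / 4) sequentially"
      by (intro order_tendstoD(2)[OF c]) auto
    then obtain M where M: "\<And>n. n \<ge> M \<Longrightarrow> c n < r\<^sup>2 / 4"
      by (auto simp: eventually_sequentially)
    have "norm (q m - q n) < r" if "m \<ge> M" "n \<ge> M" for m n
    proof -
      have "(norm (q m - q n))\<^sup>2 < r\<^sup>2"
        using par[of m n] M[OF that(1)] M[OF that(2)] by linarith
      then show ?thesis
        using \<open>0 < r\<close> power2_less_imp_less by fastforce
    qed
    then show "\<exists>M. \<forall>m\<ge>M. \<forall>n\<ge>M. norm (q m - q n) < r" by blast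
  qed
  then obtain p where p: "q \<longlonglongrightarrow> p"
    using Cauchy_convergent convergent_def by blast
  have "p \<in> S"
    using closed_sequentially[OF \<open>closed S\<close> _ p] q by blast
  have "(\<lambda>n. norm (a - q n)) \<longlonglongrightarrow> norm (a - p)"
    by (intro tendsto_intros p)
  then have "norm (a - p) = d"
    using lim_norm LIMSEQ_unique by blast
  then show ?thesis
    using that[OF \<open>p \<in> S\<close>] any_closest_point_dot[OF assms(1,2) \<open>p \<in> S\<close>] d_le
    by (simp add: dist_norm)
qed

text \<open>The projection of 0 onto the hyperplane where \<open>\<phi>\<close> equals 1 is
  orthogonal to the kernel; rescaling it gives the representing vector.\<close>

lemma Riesz_representation:
  fixes \<phi> :: "'a::{real_inner,complete_space} \<Rightarrow> real"
  assumes "bounded_linear \<phi>"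
  obtains w where "\<And>u. \<phi> u = u \<bullet> w"
proof (cases "\<forall>u. \<phi> u = 0")
  case True
  then show ?thesis using that[of 0] by simp
next
  case False
  interpret bounded_linear \<phi> by fact
  from False obtain v where v: "\<phi> v \<noteq> 0" by blast
  define S where "S = \<phi> -` {1}"
  have "closed S"
    unfolding S_def by (intro closed_vimage continuous_on linear_continuous_on assms) auto
  moreover have "convex S"
    unfolding S_def by (auto simp: convex_def add scaleR)
  moreover have "v /\<^sub>R \<phi> v \<in> S"
    using v by (simp add: S_def scaleR)
  ultimately obtain p where p: "p \<in> S" and p_dot: "\<And>q. q \<in> S \<Longrightarrow> (0 - p) \<bullet> (q - p) \<le> 0"
    using ex_projection_closed_convex[of S 0] by blast
  have p1: "\<phi> p = 1" using p by (simp add: S_def)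
  \<comment> \<open>Moving from \<open>p\<close> by \<open>w\<close> or by \<open>- w\<close> stays
    in the hyperplane, so the variational inequality holds with both signs.\<close>
  have ker: "p \<bullet> w = 0" if "\<phi> w = 0" for w
  proof -
    have "p + w \<in> S" "p - w \<in> S" using that p1 by (auto simp: S_def add diff)
    from p_dot[OF this(1)] p_dot[OF this(2)] show ?thesis by simp
  qed
  have "p \<noteq> 0" using p1 zero by auto
  have "\<phi> u = u \<bullet> (p /\<^sub>R (p \<bullet> p))" for u
  proof -
    have "p \<bullet> (u - \<phi> u *\<^sub>R p) = 0"
      by (rule ker) (simp add: diff scaleR p1)
    then show ?thesis
      using \<open>p \<noteq> 0\<close> by (simp add: inner_simps inner_commute field_simps)
  qed
  then show ?thesis by (rule that)
qed

text \<open>\<open>adjoint\<close> is a Hilbert choice among maps with this property; Riesz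
  representation of \<open>\<lambda>u. K u \<bullet> v\<close> shows that such a map exists.\<close>

lemma adjoint_Hilbert:
  fixes K :: "'a::{real_inner,complete_space} \<Rightarrow> 'b::real_inner"
  assumes "bounded_linear K"
  shows "u \<bullet> adjoint K v = K u \<bullet> v"
proof -
  have "\<exists>w. \<forall>u. K u \<bullet> v = u \<bullet> w" for v
    using Riesz_representation[OF bounded_linear_compose[OF bounded_linear_inner_left assms]]
    by metis
  then have "\<exists>K'. \<forall>u v. K u \<bullet> v = u \<bullet> K' v" by metis
  then show ?thesis
    unfolding adjoint_def by (rule someI2_ex) simp
qed

text \<open>\<open>grad\<close> is a definite description: Riesz representation of the derivative
  gives existence, uniqueness of derivatives gives uniqueness.\<close>

lemma grad_works:
  fixes \<phi> :: "'a::{real_inner,complete_space} \<Rightarrow> ereal"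
  assumes "ediff_at \<phi> u"
  shows "((\<lambda>u. real_of_ereal (\<phi> u)) has_derivative (\<lambda>d. d \<bullet> grad \<phi> u)) (at u)"
proof -
  obtain D where D: "((\<lambda>u. real_of_ereal (\<phi> u)) has_derivative D) (at u)"
    using assms by (auto simp: ediff_at_def differentiable_def)
  obtain w where w: "\<And>d. D d = d \<bullet> w"
    using Riesz_representation[OF has_derivative_bounded_linear[OF D]] by blast
  have "GDERIV (\<lambda>u. real_of_ereal (\<phi> u)) u :> w"
    using D ext[of D, OF w] by (simp add: gderiv_def)
  moreover have "w' = w" if "GDERIV (\<lambda>u. real_of_ereal (\<phi> u)) u :> w'" for w'
    using has_derivative_unique[OF D that[unfolded gderiv_def]] w
    by (metis vector_eq_ldot)
  ultimately have "GDERIV (\<lambda>u. real_of_ereal (\<phi> u)) u :> grad \<phi> u"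
    unfolding grad_def by (rule theI)
  then show ?thesis by (simp add: gderiv_def)
qed

section \<open>Extended-real convex functions\<close>

lemma ereal_real_edom:
  "proper_fun \<phi> \<Longrightarrow> u \<in> edom \<phi> \<Longrightarrow> ereal (real_of_ereal (\<phi> u)) = \<phi> u"
  by (cases "\<phi> u") (auto simp: proper_fun_def edom_def)

lemma proper_edom: "proper_fun \<phi> \<Longrightarrow> \<exists>u. u \<in> edom \<phi>"
  by (auto simp: proper_fun_def edom_def)

text \<open>Passage to real-valued convexity, for which Jensen's inequality and convexity of the
  epigraph are at hand.\<close>

lemma convex_on_edom:
  assumes "proper_fun \<phi>" "convex_fun \<phi>"
  shows "convex_on (edom \<phi>) (\<lambda>u. real_of_ereal (\<phi> u))"
proof -
  have le: "\<phi> ((1 - t) *\<^sub>R u + t *\<^sub>R v) \<le>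
      ereal ((1 - t) * real_of_ereal (\<phi> u) + t * real_of_ereal (\<phi> v))"
    if "0 < t" "t < 1" "u \<in> edom \<phi>" "v \<in> edom \<phi>" for t u v
  proof -
    have "\<phi> ((1 - t) *\<^sub>R u + t *\<^sub>R v) \<le> ereal (1 - t) * \<phi> u + ereal t * \<phi> v"
      using that assms(2) by (auto simp: convex_fun_def)
    also have "\<dots> = ereal ((1 - t) * real_of_ereal (\<phi> u) + t * real_of_ereal (\<phi> v))"
      using ereal_real_edom[OF assms(1) that(3)] ereal_real_edom[OF assms(1) that(4)]
      by (metis plus_ereal.simps(1) times_ereal.simps(1))
    finally show ?thesis .
  qed
  have in_dom: "(1 - t) *\<^sub>R u + t *\<^sub>R v \<in> edom \<phi>"
    if "0 < t" "t < 1" "u \<in> edom \<phi>" "v \<in> edom \<phi>" for t u v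
    using le[OF that] by (auto simp: edom_def)
  show ?thesis
  proof (rule convex_onI)
    show "convex (edom \<phi>)"
      unfolding convex_alt
    proof (intro ballI allI impI)
      fix u v and t :: real
      assume "u \<in> edom \<phi>" "v \<in> edom \<phi>" "0 \<le> t \<and> t \<le> 1"
      then show "(1 - t) *\<^sub>R u + t *\<^sub>R v \<in> edom \<phi>"
        using in_dom[of t u v] by (cases "t = 0 \<or> t = 1") auto
    qed
  next
    fix t :: real and u v assume *: "0 < t" "t < 1" "u \<in> edom \<phi>" "v \<in> edom \<phi>"
    then show "real_of_ereal (\<phi> ((1 - t) *\<^sub>R u + t *\<^sub>R v))
        \<le> (1 - t) * real_of_ereal (\<phi> u) + t * real_of_ereal (\<phi> v)"
      using le[OF *] in_dom[OF *] ereal_real_edom[OF assms(1)] by (metis ereal_less_eq(3))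
  qed
qed

text \<open>The filter \<open>at u\<close> omits \<open>u\<close> itself; the assumption at
  \<open>u\<close> fills the punctured neighbourhood.\<close>

lemma lsc_fun_less_eventually:
  fixes \<phi> :: "'a::topological_space \<Rightarrow> ereal"
  assumes "lsc_fun \<phi>" "c < \<phi> u"
  shows "eventually (\<lambda>v. c < \<phi> v) (nhds u)"
proof -
  have "eventually (\<lambda>v. c < \<phi> v) (at u)"
    using assms by (intro less_LiminfD) (auto simp: lsc_fun_def intro: less_le_trans)
  then show ?thesis
    using assms(2) by (auto simp: eventually_at_filter elim: eventually_mono)
qed

lemma closed_epigraph:
  fixes \<phi> :: "'a::topological_space \<Rightarrow> ereal"
  assumes "lsc_fun \<phi>"
  shows "closed {(u, r). \<phi> u \<le> ereal r}"
proof -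
  have "open (- {(u, r). \<phi> u \<le> ereal r})"
    unfolding open_subopen[of "- _"]
  proof (intro ballI)
    fix z assume "z \<in> - {(u, r). \<phi> u \<le> ereal r}"
    then obtain u r where z: "z = (u, r)" "ereal r < \<phi> u" by (cases z) auto
    \<comment> \<open>A level strictly between \<open>r\<close> and \<open>\<phi> u\<close> leaves
      room to vary both coordinates.\<close>
    obtain s where s: "ereal r < ereal s" "ereal s < \<phi> u"
      using z(2) ereal_dense2 by blast
    obtain U where U: "open U" "u \<in> U" "\<And>v. v \<in> U \<Longrightarrow> ereal s < \<phi> v"
      using lsc_fun_less_eventually[OF assms s(2)] by (auto simp: eventually_nhds)
    have "U \<times> {..<s} \<subseteq> - {(u, r). \<phi> u \<le> ereal r}"
    proof
      fix q assume q: "q \<in> U \<times> {..<s}"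
      show "q \<in> - {(u, r). \<phi> u \<le> ereal r}"
      proof
        assume "q \<in> {(u, r). \<phi> u \<le> ereal r}"
        then have "\<phi> (fst q) \<le> ereal (snd q)" by auto
        moreover have "ereal s < \<phi> (fst q)" using q by (auto intro: U(3))
        ultimately have "ereal s < ereal (snd q)" by (rule less_le_trans[rotated])
        then show False using q by auto
      qed
    qed
    then show "\<exists>T. open T \<and> z \<in> T \<and> T \<subseteq> - {(u, r). \<phi> u \<le> ereal r}"
      using U s z by (intro exI[of _ "U \<times> {..<s}"]) (auto intro: open_Times)
  qed
  then show ?thesis by (simp add: closed_def)
qed

text \<open>Separate the epigraph from a point below it; convexity of the epigraph and finiteness of
  \<open>\<phi>\<close> at the base point rule out a vertical separating hyperplane.\<close>

lemma ex_affine_minorant: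
  fixes \<phi> :: "'a::{real_inner,complete_space} \<Rightarrow> ereal"
  assumes "pcl_fun \<phi>"
  obtains w b where "\<And>u. ereal (u \<bullet> w - b) \<le> \<phi> u"
proof -
  have ppr: "proper_fun \<phi>" and conv: "convex_fun \<phi>" and lsc: "lsc_fun \<phi>"
    using assms by (auto simp: pcl_fun_def)
  define S where "S = {(u, r). \<phi> u \<le> ereal r}"
  have S_eq: "S = epigraph (edom \<phi>) (\<lambda>u. real_of_ereal (\<phi> u))"
  proof -
    have "\<phi> u \<le> ereal r \<longleftrightarrow> u \<in> edom \<phi> \<and> real_of_ereal (\<phi> u) \<le> r" for u r
      using ppr by (cases "\<phi> u") (auto simp: proper_fun_def edom_def)
    then show ?thesis by (auto simp: S_def epigraph_def)
  qed
  have "convex S"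
    unfolding S_eq by (simp add: convex_epigraph convex_on_edom[OF ppr conv])
  obtain u0 where u0: "u0 \<in> edom \<phi>" using proper_edom[OF ppr] by blast
  define r0 where "r0 = real_of_ereal (\<phi> u0)"
  have r0: "\<phi> u0 = ereal r0" using ereal_real_edom[OF ppr u0] by (simp add: r0_def)
  have "(u0, r0) \<in> S" by (simp add: S_def r0)
  \<comment> \<open>The point one unit below the graph at \<open>u0\<close> is projected onto the
    epigraph.\<close>
  then obtain z where z: "z \<in> S" and z_dot: "\<And>q. q \<in> S \<Longrightarrow> ((u0, r0 - 1) - z) \<bullet> (q - z) \<le> 0"
    using ex_projection_closed_convex[of S "(u0, r0 - 1)"] \<open>convex S\<close> closed_epigraph[OF lsc]
    unfolding S_def by blast
  obtain p s where zps: "z = (p, s)" by (cases z)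
  define c where "c = s - (r0 - 1)"
  have ps: "\<phi> p \<le> ereal s" using z by (simp add: S_def zps)
  have dot: "(u0 - p) \<bullet> (u - p) \<le> c * (r - s)" if "\<phi> u \<le> ereal r" for u r
    using z_dot[of "(u, r)"] that by (simp add: S_def zps c_def algebra_simps)
  have "\<phi> p \<le> ereal (s + 1)" using ps by (rule order_trans) simp
  from dot[OF this] have "0 \<le> c" by simp
  \<comment> \<open>\<open>- c\<close> is the vertical component of the normal. If it vanished,
    testing with \<open>(u0, r0)\<close> would give \<open>p = u0\<close>, and
    \<open>\<phi> u0\<close> would be at most \<open>r0 - 1\<close>.\<close>
  moreover have "c \<noteq> 0"
  proof
    assume "c = 0"
    then have "u0 = p" using dot[of u0 r0] r0 inner_ge_zero[of "u0 - p"] by auto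
    then show False using ps r0 \<open>c = 0\<close> by (simp add: c_def)
  qed
  ultimately have c: "c > 0" by simp
  define w where "w = (u0 - p) /\<^sub>R c"
  have "ereal (u \<bullet> w - (p \<bullet> w - s)) \<le> \<phi> u" for u
  proof (cases "u \<in> edom \<phi>")
    case True
    define r where "r = real_of_ereal (\<phi> u)"
    have r: "\<phi> u = ereal r" using ereal_real_edom[OF ppr True] by (simp add: r_def)
    have "(u0 - p) \<bullet> (u - p) \<le> c * (r - s)" by (rule dot) (simp add: r)
    then have "((u0 - p) \<bullet> (u - p)) / c \<le> r - s"
      using c by (simp add: field_simps)
    then show ?thesis
      unfolding r by (simp add: w_def inner_diff inner_commute divide_inverse algebra_simps)
  qed (auto simp: edom_def)
  then show ?thesis by (rule that)
qed

text \<open>A point where \<open>h\<close> is finite keeps the supremum above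
  \<open>-\<infinity>\<close>; the slope of an affine minorant is a point where it is below
  \<open>\<infinity>\<close>.\<close>

lemma proper_conjugate:
  fixes h :: "'a::{real_inner,complete_space} \<Rightarrow> ereal"
  assumes "pcl_fun h"
  shows "proper_fun (conjugate h)"
proof -
  have ppr: "proper_fun h" using assms by (simp add: pcl_fun_def)
  obtain u0 where u0: "u0 \<in> edom h" using proper_edom[OF ppr] by blast
  have "conjugate h w \<noteq> -\<infinity>" for w
  proof -
    have "ereal (u0 \<bullet> w) - h u0 \<le> conjugate h w"
      unfolding conjugate_def by (rule SUP_upper) simp
    then show ?thesis
      using ereal_real_edom[OF ppr u0] by (cases "h u0") auto
  qed
  moreover obtain w b where wb: "\<And>u. ereal (u \<bullet> w - b) \<le> h u"
    using ex_affine_minorant[OF assms] by blast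
  have "conjugate h w \<le> ereal b"
    unfolding conjugate_def
  proof (rule SUP_least)
    fix u show "ereal (u \<bullet> w) - h u \<le> ereal b"
      using wb[of u] by (cases "h u") auto
  qed
  then have "conjugate h w \<noteq> \<infinity>" by auto
  ultimately show ?thesis by (auto simp: proper_fun_def)
qed

text \<open>The conjugate is a supremum of affine functions.\<close>

lemma convex_conjugate:
  fixes h :: "'a::real_inner \<Rightarrow> ereal"
  assumes "proper_fun h"
  shows "convex_fun (conjugate h)"
  unfolding convex_fun_def
proof (intro allI impI)
  fix v w :: 'a and t :: real assume t: "0 < t \<and> t < 1"
  have *: "ereal (u \<bullet> ((1 - t) *\<^sub>R v + t *\<^sub>R w)) - h u
      \<le> ereal (1 - t) * conjugate h v + ereal t * conjugate h w" for u
  proof (cases "h u")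
    case (real r)
    have "ereal (u \<bullet> v) - h u \<le> conjugate h v" "ereal (u \<bullet> w) - h u \<le> conjugate h w"
      unfolding conjugate_def by (auto intro: SUP_upper)
    then have "ereal (1 - t) * ereal (u \<bullet> v - r) + ereal t * ereal (u \<bullet> w - r)
        \<le> ereal (1 - t) * conjugate h v + ereal t * conjugate h w"
      using t real by (intro add_mono ereal_mult_left_mono) auto
    then show ?thesis using real by (simp add: inner_simps algebra_simps)
  qed (use assms in \<open>auto simp: proper_fun_def\<close>)
  show "conjugate h ((1 - t) *\<^sub>R v + t *\<^sub>R w)
      \<le> ereal (1 - t) * conjugate h v + ereal t * conjugate h w"
    unfolding conjugate_def[of h "_ + _"] by (rule SUP_least) (rule *)
qed

section \<open>Smooth convex functions\<close>

lemma grad_ray_deriv: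
  fixes \<phi> :: "'a::{real_inner,complete_space} \<Rightarrow> ereal"
  assumes "ediff_at \<phi> (v + t *\<^sub>R d)"
  shows "((\<lambda>t. real_of_ereal (\<phi> (v + t *\<^sub>R d))) has_real_derivative (d \<bullet> grad \<phi> (v + t *\<^sub>R d))) (at t)"
proof -
  have "((\<lambda>t. v + t *\<^sub>R d) has_derivative (\<lambda>s. s *\<^sub>R d)) (at t)"
    by (auto intro!: derivative_eq_intros)
  from has_derivative_compose[OF this grad_works[OF assms]] show ?thesis
    by (simp add: has_field_derivative_def mult.commute[of _ "d \<bullet> _"])
qed

text \<open>Otherwise \<open>\<phi>\<close> minus its chord from \<open>v\<close> to
  \<open>u\<close> would have positive slope at \<open>v\<close>, and \<open>\<phi>\<close> would
  rise above the chord.\<close>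

lemma convex_above_tangent:
  fixes \<phi> :: "'a::{real_inner,complete_space} \<Rightarrow> ereal"
  assumes "proper_fun \<phi>" "convex_fun \<phi>" "ediff_at \<phi> v" "u \<in> edom \<phi>"
  shows "real_of_ereal (\<phi> v) + grad \<phi> v \<bullet> (u - v) \<le> real_of_ereal (\<phi> u)"
proof (rule ccontr)
  assume neg: "\<not> ?thesis"
  define F where "F u = real_of_ereal (\<phi> u)" for u
  define d where "d = u - v"
  have v: "v \<in> edom \<phi>" using assms(3) interior_subset by (auto simp: ediff_at_def)
  have "((\<lambda>t. F (v + t *\<^sub>R d) - t * (F u - F v)) has_real_derivative
      (d \<bullet> grad \<phi> v - (F u - F v))) (at 0)"
    using grad_ray_deriv[of \<phi> v 0 d] assms(3)
    by (auto intro!: derivative_eq_intros simp: F_def)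
  from DERIV_pos_inc_right[OF this] have "0 < d \<bullet> grad \<phi> v - (F u - F v) \<Longrightarrow>
      \<exists>\<eta>>0. \<forall>t>0. t < \<eta> \<longrightarrow> F v < F (v + t *\<^sub>R d) - t * (F u - F v)"
    by simp
  moreover have "0 < d \<bullet> grad \<phi> v - (F u - F v)"
    using neg by (simp add: F_def d_def inner_commute)
  ultimately have "\<exists>\<eta>>0. \<forall>t>0. t < \<eta> \<longrightarrow> F v < F (v + t *\<^sub>R d) - t * (F u - F v)"
    by blast
  then obtain \<eta> where \<eta>: "0 < \<eta>" "\<And>t. 0 < t \<Longrightarrow> t < \<eta> \<Longrightarrow> F v < F (v + t *\<^sub>R d) - t * (F u - F v)"
    by blast
  define t where "t = min 1 (\<eta> / 2)"
  have t: "0 < t" "t < \<eta>" "t \<le> 1" using \<eta>(1) by (auto simp: t_def)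
  have "F ((1 - t) *\<^sub>R v + t *\<^sub>R u) \<le> (1 - t) * F v + t * F u"
    unfolding F_def using t v assms(4) by (intro convex_onD[OF convex_on_edom[OF assms(1,2)]]) auto
  moreover have "(1 - t) *\<^sub>R v + t *\<^sub>R u = v + t *\<^sub>R d"
    by (simp add: d_def algebra_simps)
  ultimately show False using \<eta>(2)[OF t(1,2)] by (simp add: algebra_simps)
qed

text \<open>The tangent inequality bounds \<open>\<phi>\<close> on bounded parts of its domain, so by lower semicontinuity
  the domain is closed; it is open by differentiability.\<close>

lemma edom_eq_UNIV:
  fixes \<phi> :: "'a::{real_inner,complete_space} \<Rightarrow> ereal"
  assumes "pcl_fun \<phi>" and diff: "\<And>u. u \<in> edom \<phi> \<Longrightarrow> ediff_at \<phi> u"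
    and lip: "\<And>u v. u \<in> edom \<phi> \<Longrightarrow> v \<in> edom \<phi> \<Longrightarrow> norm (grad \<phi> u - grad \<phi> v) \<le> M * norm (u - v)"
  shows "edom \<phi> = UNIV"
proof -
  have ppr: "proper_fun \<phi>" and conv: "convex_fun \<phi>" and lsc: "lsc_fun \<phi>"
    using assms(1) by (auto simp: pcl_fun_def)
  obtain u0 where u0: "u0 \<in> edom \<phi>" using proper_edom[OF ppr] by blast
  have "open (edom \<phi>)"
    using diff interior_subset by (fastforce simp: ediff_at_def simp flip: interior_eq)
  moreover have "closed (edom \<phi>)"
    unfolding closed_sequential_limits
  proof (intro allI impI, elim conjE)
    fix z l assume z: "\<forall>n. z n \<in> edom \<phi>" and lim: "z \<longlonglongrightarrow> l"
    have "(\<lambda>n. norm (z n - u0)) \<longlonglongrightarrow> norm (l - u0)"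
      by (intro tendsto_intros lim)
    then have "Bseq (\<lambda>n. norm (z n - u0))"
      by (intro convergent_imp_Bseq) (auto simp: convergent_def)
    then obtain R where R: "\<And>n. norm (z n - u0) \<le> R" "R > 0"
      by (auto simp: Bseq_def)
    \<comment> \<open>The tangent inequality at \<open>z n\<close>, tested at \<open>u0\<close>,
      bounds \<open>\<phi> (z n)\<close>; the Lipschitz condition bounds the gradient at
      \<open>z n\<close>. The absolute value allows for any sign of \<open>M\<close>.\<close>
    define B where "B = real_of_ereal (\<phi> u0) + (norm (grad \<phi> u0) + \<bar>M\<bar> * R) * R"
    have bound: "\<phi> (z n) \<le> ereal B" for n
    proof -
      have "norm (grad \<phi> (z n) - grad \<phi> u0) \<le> \<bar>M\<bar> * R"
        using lip[of "z n" u0] z u0 R mult_mono[of M "\<bar>M\<bar>" "norm (z n - u0)" R]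
        by (auto intro: order_trans)
      then have "norm (grad \<phi> (z n)) \<le> norm (grad \<phi> u0) + \<bar>M\<bar> * R"
        using norm_triangle_ineq[of "grad \<phi> (z n) - grad \<phi> u0" "grad \<phi> u0"] by simp
      then have "norm (grad \<phi> (z n)) * norm (z n - u0) \<le> (norm (grad \<phi> u0) + \<bar>M\<bar> * R) * R"
        using R by (intro mult_mono) (auto intro: order_trans[OF norm_ge_zero])
      moreover have "grad \<phi> (z n) \<bullet> (z n - u0) \<le> norm (grad \<phi> (z n)) * norm (z n - u0)"
        by (rule norm_cauchy_schwarz)
      moreover have "real_of_ereal (\<phi> (z n)) + grad \<phi> (z n) \<bullet> (u0 - z n) \<le> real_of_ereal (\<phi> u0)"
        using z diff u0 by (intro convex_above_tangent ppr conv) auto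
      ultimately have "real_of_ereal (\<phi> (z n)) \<le> B"
        by (simp add: B_def inner_diff_right)
      then show ?thesis using ereal_real_edom[OF ppr, of "z n"] z by (metis ereal_less_eq(3))
    qed
    show "l \<in> edom \<phi>"
    proof (rule ccontr)
      assume "l \<notin> edom \<phi>"
      then have "ereal B < \<phi> l" by (auto simp: edom_def)
      then have "eventually (\<lambda>n. ereal B < \<phi> (z n)) sequentially"
        using lsc_fun_less_eventually[OF lsc] lim unfolding filterlim_iff by blast
      then show False using bound by (auto simp: eventually_sequentially not_less[symmetric])
    qed
  qed
  ultimately show ?thesis
    using u0 clopen[of "edom \<phi>"] by auto
qed

text \<open>Along the segment from \<open>v\<close> to \<open>u\<close>, \<open>\<phi>\<close> minus
  its quadratic model has nonpositive derivative; the values at the two ends are compared.\<close>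

lemma descent_lemma:
  fixes \<phi> :: "'a::{real_inner,complete_space} \<Rightarrow> ereal"
  assumes diff: "\<And>u. ediff_at \<phi> u"
    and lip: "\<And>u v. norm (grad \<phi> u - grad \<phi> v) \<le> M * norm (u - v)"
  shows "real_of_ereal (\<phi> u) \<le> real_of_ereal (\<phi> v) + grad \<phi> v \<bullet> (u - v) + M / 2 * (norm (u - v))\<^sup>2"
proof -
  define d where "d = u - v"
  define \<psi> where "\<psi> t = real_of_ereal (\<phi> (v + t *\<^sub>R d)) - t * (grad \<phi> v \<bullet> d) - t\<^sup>2 * (M / 2 * (norm d)\<^sup>2)"
    for t :: real
  have "\<psi> 1 \<le> \<psi> 0"
  proof (rule DERIV_nonpos_imp_nonincreasing[of 0 1 \<psi>])
    fix t :: real assume t: "0 \<le> t" "t \<le> 1"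
    have "(\<psi> has_real_derivative
        (d \<bullet> grad \<phi> (v + t *\<^sub>R d) - grad \<phi> v \<bullet> d - t * (M * (norm d)\<^sup>2))) (at t)"
      unfolding \<psi>_def
      by (auto intro!: derivative_eq_intros grad_ray_deriv diff)
    moreover have "d \<bullet> grad \<phi> (v + t *\<^sub>R d) - grad \<phi> v \<bullet> d \<le> t * (M * (norm d)\<^sup>2)"
    proof -
      have "d \<bullet> grad \<phi> (v + t *\<^sub>R d) - grad \<phi> v \<bullet> d = (grad \<phi> (v + t *\<^sub>R d) - grad \<phi> v) \<bullet> d"
        by (simp add: inner_simps inner_commute)
      also have "\<dots> \<le> norm (grad \<phi> (v + t *\<^sub>R d) - grad \<phi> v) * norm d"
        by (rule norm_cauchy_schwarz)
      also have "\<dots> \<le> (M * norm (t *\<^sub>R d)) * norm d"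
        using lip[of "v + t *\<^sub>R d" v] by (intro mult_right_mono) auto
      finally show ?thesis using t by (simp add: power2_eq_square mult_ac)
    qed
    ultimately show "\<exists>D. (\<psi> has_real_derivative D) (at t) \<and> D \<le> 0"
      by (intro exI conjI) auto
  qed simp
  then show ?thesis by (simp add: \<psi>_def d_def)
qed

section \<open>Inexact proximal points\<close>

text \<open>An infinite value at \<open>z\<close> would violate the subgradient inequality at any
  point of the domain.\<close>

lemma approx_prox2_edom:
  assumes "proper_fun \<phi>" "approx_prox2 \<epsilon> lam \<phi> v z"
  shows "z \<in> edom \<phi>"
proof -
  obtain u where u: "u \<in> edom \<phi>" using proper_edom[OF assms(1)] by blast
  have "\<phi> z + ereal (((v - z) /\<^sub>R lam) \<bullet> (u - z)) - ereal \<epsilon> \<le> \<phi> u"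
    using assms(2) by (auto simp: approx_prox2_def eps_subdiff_def)
  then show ?thesis using u by (cases "\<phi> z") (auto simp: edom_def)
qed

lemma approx_prox2_ineq:
  assumes "proper_fun \<phi>" "approx_prox2 \<epsilon> lam \<phi> v z" "u \<in> edom \<phi>"
  shows "real_of_ereal (\<phi> z) + ((v - z) \<bullet> (u - z)) / lam - \<epsilon> \<le> real_of_ereal (\<phi> u)"
proof -
  have "\<phi> z + ereal (((v - z) /\<^sub>R lam) \<bullet> (u - z)) - ereal \<epsilon> \<le> \<phi> u"
    using assms(2) by (auto simp: approx_prox2_def eps_subdiff_def)
  then show ?thesis
    using ereal_real_edom[OF assms(1,3)] ereal_real_edom[OF assms(1) approx_prox2_edom[OF assms(1,2)]]
    by (cases "\<phi> z"; cases "\<phi> u") (auto simp: divide_inverse mult.commute)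
qed

lemma is_prox_imp_approx_prox1:
  "is_prox lam \<phi> v z \<Longrightarrow> approx_prox1 0 lam \<phi> v z"
  by (auto simp: is_prox_def approx_prox1_def eps_subdiff_def is_arg_min_def not_less
      simp flip: zero_ereal_def)

lemma approx_prox1_edom:
  assumes "proper_fun \<phi>" "approx_prox1 \<epsilon> lam \<phi> v z"
  shows "z \<in> edom \<phi>"
proof -
  obtain u where u: "u \<in> edom \<phi>" using proper_edom[OF assms(1)] by blast
  have "prox_obj lam \<phi> v z - ereal \<epsilon> \<le> prox_obj lam \<phi> v u"
    using assms(2) by (auto simp: approx_prox1_def eps_subdiff_def simp flip: zero_ereal_def)
  then show ?thesis using u by (cases "\<phi> z") (auto simp: edom_def prox_obj_def)
qed

text \<open>Near-minimality of \<open>z\<close> is tested along the segment from \<open>z\<close> to \<open>u\<close>.\<close>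

lemma approx_prox1_segment:
  assumes "proper_fun \<phi>" "convex_fun \<phi>" "approx_prox1 \<epsilon> lam \<phi> v z" "u \<in> edom \<phi>" "lam > 0"
    and t: "0 < t" "t \<le> 1"
  shows "real_of_ereal (\<phi> z) + ((v - z) \<bullet> (u - z)) / lam - t * (norm (u - z))\<^sup>2 / (2 * lam) - \<epsilon> / t
    \<le> real_of_ereal (\<phi> u)"
proof -
  define F where "F u = real_of_ereal (\<phi> u)" for u
  define d where "d = u - z"
  define w where "w = (1 - t) *\<^sub>R z + t *\<^sub>R u"
  have z: "z \<in> edom \<phi>" by (rule approx_prox1_edom[OF assms(1,3)])
  have cvx: "convex_on (edom \<phi>) F" unfolding F_def by (rule convex_on_edom[OF assms(1,2)])
  have w: "w \<in> edom \<phi>"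
    using convex_on_imp_convex[OF cvx] z assms(4) t unfolding w_def convex_alt by auto
  have "prox_obj lam \<phi> v z - ereal \<epsilon> \<le> prox_obj lam \<phi> v w"
    using assms(3) by (auto simp: approx_prox1_def eps_subdiff_def simp flip: zero_ereal_def)
  then have "(norm (z - v))\<^sup>2 / (2 * lam) + F z - \<epsilon> \<le> (norm (w - v))\<^sup>2 / (2 * lam) + F w"
    using ereal_real_edom[OF assms(1) z] ereal_real_edom[OF assms(1) w]
    by (cases "\<phi> z"; cases "\<phi> w") (auto simp: prox_obj_def F_def)
  moreover have "F w \<le> (1 - t) * F z + t * F u"
    unfolding w_def using t z assms(4) by (intro convex_onD[OF cvx]) auto
  \<comment> \<open>Since \<open>w - v = (z - v) + t *\<^sub>R d\<close>, the part linear in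
    \<open>t\<close> gives the subgradient term and the quadratic part the loss.\<close>
  moreover have "(norm (w - v))\<^sup>2 = (norm (z - v))\<^sup>2 - 2 * t * ((v - z) \<bullet> d) + t\<^sup>2 * (norm d)\<^sup>2"
    unfolding power2_norm_eq_inner w_def d_def
    by (simp add: inner_simps inner_commute power2_eq_square algebra_simps)
  ultimately have "t * F z + t * ((v - z) \<bullet> d) / lam - t\<^sup>2 * (norm d)\<^sup>2 / (2 * lam) - \<epsilon> \<le> t * F u"
    using \<open>lam > 0\<close> by (simp add: add_divide_distrib diff_divide_distrib algebra_simps)
  then have "(t * F z + t * ((v - z) \<bullet> d) / lam - t\<^sup>2 * (norm d)\<^sup>2 / (2 * lam) - \<epsilon>) / t \<le> F u"
    using t by (simp add: divide_le_eq mult.commute)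
  moreover have "(t * F z + t * ((v - z) \<bullet> d) / lam - t\<^sup>2 * (norm d)\<^sup>2 / (2 * lam) - \<epsilon>) / t
     = F z + ((v - z) \<bullet> d) / lam - t * (norm d)\<^sup>2 / (2 * lam) - \<epsilon> / t"
    using t by (simp add: add_divide_distrib diff_divide_distrib power2_eq_square)
  ultimately show ?thesis by (simp add: F_def d_def)
qed

text \<open>The segment inequality is optimised over \<open>t\<close>: the loss
  \<open>t * D\<^sup>2 / (2 * lam) + \<epsilon> / t\<close> has minimal value \<open>s * D\<close>,
  attained at \<open>t = lam * s / D\<close>. If that exceeds 1, the choice \<open>t = 1\<close>
  costs the additional \<open>\<epsilon>\<close>.\<close>

lemma approx_prox1_ineq:
  assumes "proper_fun \<phi>" "convex_fun \<phi>" "approx_prox1 \<epsilon> lam \<phi> v z" "u \<in> edom \<phi>"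
    and lam: "lam > 0" and \<epsilon>: "\<epsilon> \<ge> 0"
  shows "real_of_ereal (\<phi> z) + ((v - z) \<bullet> (u - z)) / lam - sqrt (2 * \<epsilon> / lam) * norm (u - z) - \<epsilon>
    \<le> real_of_ereal (\<phi> u)"
proof -
  define F where "F u = real_of_ereal (\<phi> u)" for u
  define D where "D = norm (u - z)"
  define s where "s = sqrt (2 * \<epsilon> / lam)"
  have s: "s \<ge> 0" "\<epsilon> = lam * s\<^sup>2 / 2" using lam \<epsilon> by (auto simp: s_def)
  have D: "D \<ge> 0" by (simp add: D_def)
  have seg: "F z + ((v - z) \<bullet> (u - z)) / lam - t * D\<^sup>2 / (2 * lam) - \<epsilon> / t \<le> F u"
    if "0 < t" "t \<le> 1" for t
    unfolding F_def D_def using approx_prox1_segment[OF assms(1-5) that] .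
  have "F z + ((v - z) \<bullet> (u - z)) / lam - s * D - \<epsilon> \<le> F u"
  proof (cases "D \<le> lam * s")
    case True
    have "D\<^sup>2 / (2 * lam) \<le> s * D"
    proof -
      have "D * D \<le> (lam * s) * D" using True D by (rule mult_right_mono)
      then have "D * D / lam \<le> s * D" using lam by (simp add: divide_le_eq mult_ac)
      moreover have "D * D / lam / 2 \<le> D * D / lam" using lam D by (simp add: field_simps)
      ultimately show ?thesis by (simp add: power2_eq_square)
    qed
    then show ?thesis using seg[of 1] by simp
  next
    case False
    show ?thesis
    proof (cases "s = 0")
      \<comment> \<open>Here \<open>\<epsilon> = 0\<close> and the optimal parameter degenerates to
        0, so small positive values are used; the summand 1 in the denominator below keeps it
        positive.\<close>
      case True
      have "\<epsilon> = 0" using s True by simp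
      then have "F z + ((v - z) \<bullet> (u - z)) / lam \<le> F u + t" if "0 < t" for t
      proof -
        define r where "r = min 1 (t * (2 * lam) / (D\<^sup>2 + 1))"
        have r: "0 < r" "r \<le> 1" "r * D\<^sup>2 / (2 * lam) \<le> t"
        proof -
          have p: "D\<^sup>2 + 1 > 0" by (smt (verit) zero_le_power2)
          then show "0 < r" "r \<le> 1" using that lam by (auto simp: r_def)
          have "r * D\<^sup>2 \<le> (t * (2 * lam) / (D\<^sup>2 + 1)) * (D\<^sup>2 + 1)"
            using that lam p by (intro mult_mono) (auto simp: r_def)
          also have "\<dots> = t * (2 * lam)" using p by simp
          finally show "r * D\<^sup>2 / (2 * lam) \<le> t"
            using lam by (simp add: divide_le_eq)
        qed
        then show ?thesis using seg[OF r(1,2)] \<open>\<epsilon> = 0\<close> by simp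
      qed
      then have "F z + ((v - z) \<bullet> (u - z)) / lam \<le> F u" by (rule field_le_epsilon)
      then show ?thesis using True \<open>\<epsilon> = 0\<close> by simp
    next
      case nz: False
      then have "s > 0" using s by simp
      with False have "D > 0" using lam by (smt (verit) mult_pos_pos)
      define t where "t = lam * s / D"
      have "0 < t" "t \<le> 1" using False \<open>s > 0\<close> \<open>D > 0\<close> lam by (auto simp: t_def)
      moreover have "t * D\<^sup>2 / (2 * lam) = s * D / 2" "\<epsilon> / t = s * D / 2"
        using \<open>s > 0\<close> \<open>D > 0\<close> lam by (auto simp: t_def s(2) power2_eq_square field_simps)
      ultimately show ?thesis using seg[of t] \<epsilon> by linarith
    qed
  qed
  then show ?thesis by (simp add: F_def D_def s_def)
qed

text \<open>An exact proximal point of the shifted centre satisfies the exact inequality there;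
  Cauchy-Schwarz bounds the contribution of the shift, as \<open>sqrt (2 * lam * \<epsilon>) = lam *
  sqrt (2 * \<epsilon> / lam)\<close>.\<close>

lemma approx_prox3_ineq:
  assumes "proper_fun \<phi>" "convex_fun \<phi>" "approx_prox3 \<epsilon> lam \<phi> v z" "u \<in> edom \<phi>"
    and lam: "lam > 0" and \<epsilon>: "\<epsilon> \<ge> 0"
  shows "real_of_ereal (\<phi> z) + ((v - z) \<bullet> (u - z)) / lam - sqrt (2 * \<epsilon> / lam) * norm (u - z)
    \<le> real_of_ereal (\<phi> u)"
proof -
  obtain r where r: "norm r \<le> sqrt (2 * lam * \<epsilon>)" "is_prox lam \<phi> (v + r) z"
    using assms(3) by (auto simp: approx_prox3_def)
  have "real_of_ereal (\<phi> z) + ((v + r - z) \<bullet> (u - z)) / lam \<le> real_of_ereal (\<phi> u)"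
    using approx_prox1_ineq[OF assms(1,2) is_prox_imp_approx_prox1[OF r(2)] assms(4) lam] by simp
  moreover have "(r \<bullet> (u - z)) / lam \<ge> - (sqrt (2 * \<epsilon> / lam) * norm (u - z))"
  proof -
    have "- (r \<bullet> (u - z)) \<le> norm r * norm (u - z)"
      using norm_cauchy_schwarz[of "- r" "u - z"] by simp
    also have "\<dots> \<le> sqrt (2 * lam * \<epsilon>) * norm (u - z)"
      by (intro mult_right_mono r) simp
    also have "sqrt (2 * lam * \<epsilon>) = lam * sqrt (2 * \<epsilon> / lam)"
    proof -
      have "2 * lam * \<epsilon> = lam\<^sup>2 * (2 * \<epsilon> / lam)" using lam by (simp add: power2_eq_square)
      then show ?thesis using lam by (simp only: real_sqrt_mult real_sqrt_abs abs_of_pos)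
    qed
    finally show ?thesis using lam by (simp add: field_simps)
  qed
  ultimately show ?thesis by (simp add: inner_simps add_divide_distrib diff_divide_distrib)
qed

lemma approx_prox_edom:
  assumes "proper_fun \<phi>" "approx_prox i \<epsilon> lam \<phi> v z"
  shows "z \<in> edom \<phi>"
  using assms(2) approx_prox1_edom[OF assms(1)] approx_prox2_edom[OF assms(1)]
    is_prox_imp_approx_prox1
  by (fastforce simp: approx_prox_def approx_prox3_def)

text \<open>Common form for the energy estimate: type 2 incurs only \<open>\<epsilon>\<close>, type
  3 only the distance term, type 1 both.\<close>

lemma approx_prox_ineq:
  assumes "proper_fun \<phi>" "convex_fun \<phi>" "approx_prox i \<epsilon> lam \<phi> v z" "u \<in> edom \<phi>"
    and lam: "lam > 0" and \<epsilon>: "\<epsilon> \<ge> 0"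
  shows "real_of_ereal (\<phi> z) + ((v - z) \<bullet> (u - z)) / lam
    - (if i = 2 then 0 else sqrt (2 * \<epsilon> / lam)) * norm (u - z) - \<epsilon> \<le> real_of_ereal (\<phi> u)"
  using assms(3) approx_prox1_ineq[OF assms(1,2) _ assms(4-6)] approx_prox2_ineq[OF assms(1) _ assms(4)]
    approx_prox3_ineq[OF assms(1,2) _ assms(4-6)] \<epsilon>
  by (fastforce simp: approx_prox_def)

section \<open>The energy estimate\<close>

text \<open>Lyapunov function of the iteration; \<open>x'\<close> is the primal iterate preceding \<open>x\<close>.\<close>

definition pd_energy ::
    "('a::real_inner \<Rightarrow> 'b::real_inner) \<Rightarrow> real \<Rightarrow> real \<Rightarrow> 'a \<Rightarrow> 'b \<Rightarrow> 'a \<Rightarrow> 'b \<Rightarrow> 'a \<Rightarrow> real" where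
  "pd_energy K \<tau> \<sigma> xs ys x y x' = (norm (x - xs))\<^sup>2 / (2 * \<tau>) + (norm (y - ys))\<^sup>2 / (2 * \<sigma>)
     + \<sigma> * (onorm K)\<^sup>2 / 2 * (norm (x - x'))\<^sup>2 - K (x - x') \<bullet> (ys - y)"

text \<open>Cauchy-Schwarz followed by completing a square, with the weights that occur in
  \<open>pd_energy\<close>.\<close>

lemma bounded_linear_inner_Young:
  fixes K :: "'a::real_inner \<Rightarrow> 'b::real_inner"
  assumes "bounded_linear K" "\<sigma> > 0"
  shows "K u \<bullet> v \<le> \<sigma> * (onorm K)\<^sup>2 / 2 * (norm u)\<^sup>2 + (norm v)\<^sup>2 / (2 * \<sigma>)"
proof -
  define a where "a = onorm K * norm u"
  have "K u \<bullet> v \<le> norm (K u) * norm v" by (rule norm_cauchy_schwarz)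
  also have "\<dots> \<le> a * norm v"
    unfolding a_def by (intro mult_right_mono onorm assms) simp
  also have "a * norm v \<le> \<sigma> * a\<^sup>2 / 2 + (norm v)\<^sup>2 / (2 * \<sigma>)"
  proof -
    have "0 \<le> (\<sigma> * a - norm v)\<^sup>2 / (2 * \<sigma>)" using assms by simp
    also have "\<dots> = \<sigma> * a\<^sup>2 / 2 + (norm v)\<^sup>2 / (2 * \<sigma>) - a * norm v"
      using assms by (simp add: field_simps power2_eq_square)
    finally show ?thesis by simp
  qed
  finally show ?thesis by (simp add: a_def power_mult_distrib)
qed

text \<open>Young's inequality absorbs the coupling term into the squares of \<open>x - x'\<close>
  and \<open>y - ys\<close>.\<close>

lemma pd_energy_lower:
  fixes K :: "'a::real_inner \<Rightarrow> 'b::real_inner"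
  assumes "bounded_linear K" "\<sigma> > 0"
  shows "(norm (x - xs))\<^sup>2 / (2 * \<tau>) \<le> pd_energy K \<tau> \<sigma> xs ys x y x'"
  using bounded_linear_inner_Young[OF assms, of "x - x'" "ys - y"]
  by (simp add: pd_energy_def norm_minus_commute)

text \<open>The algebra of one step: \<open>w\<close> stands for the adjoint at \<open>y1\<close>,
  \<open>d\<close> for the gradient of \<open>f\<close> at \<open>x0\<close>, and \<open>F\<close>,
  \<open>G\<close>, \<open>H\<close> for values of \<open>f\<close>, \<open>g\<close> and the
  conjugate of \<open>h\<close>. The prox inequalities are tested at the saddle point and added to
  the bounds on \<open>f\<close>.\<close>

lemma pd_energy_step:
  fixes K :: "'a::real_inner \<Rightarrow> 'b::real_inner"
  assumes K: "bounded_linear K" and pos: "\<tau> > 0" "\<sigma> > 0"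
    and step: "\<tau> * Lf + \<sigma> * \<tau> * (onorm K)\<^sup>2 \<le> 1"
    and adj: "\<And>u. u \<bullet> w = K u \<bullet> y1"
    and tangent: "F0 + d \<bullet> (xs - x0) \<le> Fs"
    and descent: "F1 \<le> F0 + d \<bullet> (x1 - x0) + Lf / 2 * (norm (x1 - x0))\<^sup>2"
    and primal: "G1 + ((x0 - \<tau> *\<^sub>R (w + d + e) - x1) \<bullet> (xs - x1)) / \<tau> - \<rho> * norm (xs - x1) - \<epsilon> \<le> Gs"
    and dual: "H1 + ((y0 + \<sigma> *\<^sub>R K (2 *\<^sub>R x0 - x') - y1) \<bullet> (ys - y1)) / \<sigma> - \<delta> \<le> Hs"
  shows "(K x1 \<bullet> ys + F1 + G1 - Hs) - (K xs \<bullet> y1 + Fs + Gs - H1)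
      \<le> pd_energy K \<tau> \<sigma> xs ys x0 y0 x' - pd_energy K \<tau> \<sigma> xs ys x1 y1 x0
        + (norm e + \<rho>) * norm (x1 - xs) + (\<epsilon> + \<delta>)"
proof -
  interpret bounded_linear K by fact
  \<comment> \<open>Turns the inner products of the prox inequalities into squares that
    telescope.\<close>
  have three_point: "(u - v) \<bullet> (z - v) = ((norm (v - z))\<^sup>2 + (norm (v - u))\<^sup>2 - (norm (u - z))\<^sup>2) / 2"
    for u v z :: "'c::real_inner"
    unfolding power2_norm_eq_inner by (simp add: inner_simps inner_commute algebra_simps)
  have e: "- (e \<bullet> (xs - x1)) \<ge> - (norm e * norm (x1 - xs))"
    using norm_cauchy_schwarz[of e "xs - x1"] by (simp add: norm_minus_commute)
  have "((x0 - \<tau> *\<^sub>R (w + d + e) - x1) \<bullet> (xs - x1)) / \<tau>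
      = ((x0 - x1) \<bullet> (xs - x1)) / \<tau> - w \<bullet> (xs - x1) - d \<bullet> (xs - x1) - e \<bullet> (xs - x1)"
    using pos by (simp add: inner_simps field_simps)
  also have "w \<bullet> (xs - x1) = K (xs - x1) \<bullet> y1" by (simp add: inner_commute[of w] adj)
  finally have primal': "G1 + ((norm (x1 - xs))\<^sup>2 + (norm (x1 - x0))\<^sup>2 - (norm (x0 - xs))\<^sup>2) / (2 * \<tau>)
      - K (xs - x1) \<bullet> y1 - d \<bullet> (xs - x1) - (norm e + \<rho>) * norm (x1 - xs) - \<epsilon> \<le> Gs"
    using primal e by (simp add: three_point norm_minus_commute[of xs x1] distrib_right)
  have "((y0 + \<sigma> *\<^sub>R K (2 *\<^sub>R x0 - x') - y1) \<bullet> (ys - y1)) / \<sigma>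
      = ((y0 - y1) \<bullet> (ys - y1)) / \<sigma> + K (2 *\<^sub>R x0 - x') \<bullet> (ys - y1)"
    using pos by (simp add: inner_simps field_simps)
  then have dual': "H1 + ((norm (y1 - ys))\<^sup>2 + (norm (y1 - y0))\<^sup>2 - (norm (y0 - ys))\<^sup>2) / (2 * \<sigma>)
      + K (2 *\<^sub>R x0 - x') \<bullet> (ys - y1) - \<delta> \<le> Hs"
    using dual by (simp add: three_point)
  have F: "F1 - Fs \<le> d \<bullet> (x1 - xs) + Lf / 2 * (norm (x1 - x0))\<^sup>2"
    using tangent descent by (simp add: inner_simps)
  have Young: "K (x0 - x') \<bullet> (y1 - y0) \<le> \<sigma> * (onorm K)\<^sup>2 / 2 * (norm (x0 - x'))\<^sup>2 + (norm (y1 - y0))\<^sup>2 / (2 * \<sigma>)"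
    by (rule bounded_linear_inner_Young[OF K pos(2)])
  \<comment> \<open>By the step-size condition, the square of \<open>x1 - x0\<close> gained from the
    primal prox step pays both for the descent lemma and for the term
    \<open>\<sigma> * (onorm K)\<^sup>2 / 2\<close> of the new energy.\<close>
  have "(Lf + \<sigma> * (onorm K)\<^sup>2) * (norm (x1 - x0))\<^sup>2 \<le> 1 / \<tau> * (norm (x1 - x0))\<^sup>2"
    using step pos by (intro mult_right_mono) (auto simp: field_simps)
  then have coef: "Lf / 2 * (norm (x1 - x0))\<^sup>2 + \<sigma> * (onorm K)\<^sup>2 / 2 * (norm (x1 - x0))\<^sup>2
      \<le> (norm (x1 - x0))\<^sup>2 / (2 * \<tau>)"
    by (simp add: algebra_simps)
  \<comment> \<open>Extrapolation makes the bilinear terms telescope as the coupling terms of the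
    two energies, except for the last one, which \<open>Young\<close> controls.\<close>
  have bil: "K x1 \<bullet> ys - K xs \<bullet> y1 + K (xs - x1) \<bullet> y1 - K (2 *\<^sub>R x0 - x') \<bullet> (ys - y1)
      = K (x1 - x0) \<bullet> (ys - y1) - K (x0 - x') \<bullet> (ys - y0) + K (x0 - x') \<bullet> (y1 - y0)"
    by (simp add: diff add scaleR inner_simps scaleR_2)
  have "d \<bullet> (xs - x1) = - (d \<bullet> (x1 - xs))" by (simp add: inner_simps)
  then show ?thesis
    unfolding pd_energy_def
    using primal' dual' F Young coef bil
    by (simp add: add_divide_distrib diff_divide_distrib norm_minus_commute)
qed

section \<open>Error accumulation\<close>

text \<open>The bound on the largest of \<open>a 1, \<dots>, a N\<close> is a quadratic inequality in that maximum.\<close>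

lemma error_sum_bound:
  fixes a E s :: "nat \<Rightarrow> real"
  assumes ineq: "\<And>N. p * (a N)\<^sup>2 \<le> C + (\<Sum>n=1..N. E n * a n + s n)"
    and a: "\<And>n. 0 \<le> a n" and E: "\<And>n. n \<ge> 1 \<Longrightarrow> 0 \<le> E n" and s: "\<And>n. n \<ge> 1 \<Longrightarrow> 0 \<le> s n" and p: "p > 0"
  shows "(\<Sum>n=1..N. E n * a n) \<le> C + (\<Sum>n=1..N. s n) + (\<Sum>n=1..N. E n)\<^sup>2 / p"
proof -
  define m where "m = Max (a ` {..N})"
  define S where "S = (\<Sum>n=1..N. s n)"
  define T where "T = (\<Sum>n=1..N. E n)"
  have "m \<in> a ` {..N}" unfolding m_def by (intro Max_in) auto
  then obtain k where k: "k \<le> N" "m = a k" by auto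
  have le_m: "a n \<le> m" if "n \<le> N" for n unfolding m_def using that by (intro Max_ge) auto
  have m0: "0 \<le> m" using k a by simp
  have sum_le: "(\<Sum>n=1..N. E n * a n) \<le> T * m"
    unfolding T_def sum_distrib_right using E le_m by (intro sum_mono mult_left_mono) auto
  \<comment> \<open>The maximum is attained at \<open>k\<close>, so the hypothesis is used at
    \<open>k\<close>; its sum is extended to \<open>N\<close> by nonnegative terms.\<close>
  have "(\<Sum>n=1..k. E n * a n + s n) \<le> (\<Sum>n=1..N. E n * a n + s n)"
    using k a E s by (intro sum_mono2) (auto intro!: add_nonneg_nonneg mult_nonneg_nonneg)
  also have "\<dots> \<le> T * m + S" using sum_le by (simp add: sum.distrib S_def)
  finally have "p * m\<^sup>2 \<le> C + (T * m + S)" using ineq[of k] k by simp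
  \<comment> \<open>Weighted so that half of \<open>p * m\<^sup>2\<close> is absorbed by the left
    side of the quadratic inequality.\<close>
  moreover have "T * m \<le> T\<^sup>2 / (2 * p) + p * m\<^sup>2 / 2"
  proof -
    have "0 \<le> (T - p * m)\<^sup>2 / (2 * p)" using p by simp
    also have "\<dots> = T\<^sup>2 / (2 * p) + p * m\<^sup>2 / 2 - T * m"
      using p by (simp add: field_simps power2_eq_square)
    finally show ?thesis by simp
  qed
  ultimately have "T * m \<le> C + S + 2 * (T\<^sup>2 / (2 * p))" by simp
  then show ?thesis using sum_le by (simp add: S_def T_def)
qed

lemma bigo_powr_bound:
  fixes f :: "nat \<Rightarrow> real"
  assumes "f \<in> O(\<lambda>n. real n powr q)"
  obtains C where "C \<ge> 0" "\<And>n. n \<ge> 1 \<Longrightarrow> \<bar>f n\<bar> \<le> C * real n powr q"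
proof -
  obtain c where c: "c > 0" "eventually (\<lambda>n. norm (f n) \<le> c * norm (real n powr q)) sequentially"
    using assms by (rule landau_o.bigE)
  then obtain n0 where n0: "\<And>n. n \<ge> n0 \<Longrightarrow> \<bar>f n\<bar> \<le> c * real n powr q"
    by (auto simp: eventually_sequentially)
  \<comment> \<open>The finitely many indices below the threshold are covered by adding their ratios
    to \<open>c\<close>.\<close>
  define C where "C = c + (\<Sum>n<n0. \<bar>f n\<bar> / real n powr q)"
  have sum0: "0 \<le> (\<Sum>n<n0. \<bar>f n\<bar> / real n powr q)" by (intro sum_nonneg) auto
  have "\<bar>f n\<bar> \<le> C * real n powr q" if "n \<ge> 1" for n
  proof (cases "n < n0")
    case True
    then have "\<bar>f n\<bar> / real n powr q \<le> (\<Sum>n<n0. \<bar>f n\<bar> / real n powr q)"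
      by (intro member_le_sum) auto
    then have "\<bar>f n\<bar> / real n powr q \<le> C" using c by (simp add: C_def)
    then show ?thesis using that by (simp add: divide_le_eq)
  next
    case False
    have "c * real n powr q \<le> C * real n powr q"
      using sum0 by (intro mult_right_mono) (auto simp: C_def)
    then show ?thesis using n0[of n] False by simp
  qed
  then show ?thesis using that[of C] c sum0 by (simp add: C_def)
qed

text \<open>Each summand is compared, by the mean value theorem, with an increment of the
  antiderivative.\<close>

lemma sum_powr_le_powr:
  fixes p :: real
  assumes "0 \<le> p" "p < 1"
  shows "(\<Sum>n=1..N. real n powr (- p)) \<le> real N powr (1 - p) / (1 - p)"
proof (induction N)
  case (Suc N)
  have "(1 - p) * real (Suc N) powr (- p) \<le> real (Suc N) powr (1 - p) - real N powr (1 - p)"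
  proof (cases "N = 0")
    case True
    then show ?thesis using assms by simp
  next
    case False
    have "\<exists>z>real N. z < real (Suc N) \<and>
        real (Suc N) powr (1 - p) - real N powr (1 - p) = (real (Suc N) - real N) * ((1 - p) * z powr (1 - p - 1))"
      using False by (intro MVT2 has_real_derivative_powr) auto
    then obtain z where z: "real N < z" "z < real (Suc N)"
      "real (Suc N) powr (1 - p) - real N powr (1 - p) = (1 - p) * z powr (- p)"
      by auto
    have "real (Suc N) powr (- p) \<le> z powr (- p)"
      using z assms False by (intro powr_mono2') auto
    then show ?thesis using z(3) assms by simp
  qed
  then have "real (Suc N) powr (- p) \<le> (real (Suc N) powr (1 - p) - real N powr (1 - p)) / (1 - p)"
    using assms by (simp add: le_divide_eq mult.commute)
  then show ?case using Suc.IH by (simp add: diff_divide_distrib)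
qed simp

lemma sum_inverse_le_ln:
  assumes "N \<ge> 1"
  shows "(\<Sum>n=1..N. real n powr (- 1)) \<le> 1 + ln (real N)"
  using assms
proof (induction N rule: nat_induct_at_least)
  case (Suc N)
  \<comment> \<open>\<open>ln z \<le> z - 1\<close> at this quotient compares the new summand with
    an increment of \<open>ln\<close>.\<close>
  have "ln (real N / real (Suc N)) \<le> real N / real (Suc N) - 1"
    using Suc.hyps by (intro ln_le_minus_one) auto
  also have "\<dots> = - (1 / real (Suc N))" by (simp add: field_simps)
  finally have "1 / real (Suc N) \<le> ln (real (Suc N)) - ln (real N)"
    using Suc.hyps by (simp add: ln_div)
  then show ?case using Suc.IH by (simp add: powr_minus_divide)
qed simp

lemma sum_powr_bounded:
  fixes p :: real
  assumes "p > 1"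
  shows "(\<Sum>n=1..N. real n powr (- p)) \<le> (\<Sum>n. real n powr (- p))"
  using assms by (intro sum_le_suminf) (auto simp: summable_real_powr_iff)

text \<open>Squaring the sum of the \<open>n powr (- (\<alpha> + 1/2))\<close> is what produces \<open>ln\<^sup>2 N\<close> at \<open>\<alpha> = 1/2\<close>.\<close>

lemma ergodic_rate:
  fixes v :: "nat \<Rightarrow> real"
  assumes \<alpha>: "\<alpha> > 0" and v0: "\<And>N. N \<ge> 1 \<Longrightarrow> 0 \<le> v N"
    and bound: "\<And>N. N \<ge> 1 \<Longrightarrow> real N * v N \<le> C * (1 + (\<Sum>n=1..N. real n powr (- (2 * \<alpha>)))
        + (\<Sum>n=1..N. real n powr (- (\<alpha> + 1/2)))\<^sup>2)"
    and C: "C \<ge> 0"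
  shows "\<alpha> > 1/2 \<Longrightarrow> v \<in> O(\<lambda>N. 1 / real N)"
    and "\<alpha> = 1/2 \<Longrightarrow> v \<in> O(\<lambda>N. (ln (real N))\<^sup>2 / real N)"
    and "\<alpha> < 1/2 \<Longrightarrow> v \<in> O(\<lambda>N. real N powr (- (2 * \<alpha>)))"
proof -
  define S where "S N = (\<Sum>n=1..N. real n powr (- (2 * \<alpha>)))" for N :: nat
  define T where "T N = (\<Sum>n=1..N. real n powr (- (\<alpha> + 1/2)))" for N :: nat
  have T0: "0 \<le> T N" for N unfolding T_def by (intro sum_nonneg) auto
  \<comment> \<open>All three regimes reduce to dominating \<open>1 + S N + (T N)\<^sup>2\<close> by
    a multiple of \<open>b N\<close> for large \<open>N\<close>.\<close>
  have main: "v \<in> O(\<lambda>N. b N / real N)"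
    if b: "\<And>N. N \<ge> n0 \<Longrightarrow> 1 + S N + (T N)\<^sup>2 \<le> c * b N" for b :: "nat \<Rightarrow> real" and c n0
  proof (rule landau_o.bigI[of "\<bar>C * c\<bar> + 1"])
    show "eventually (\<lambda>N. norm (v N) \<le> (\<bar>C * c\<bar> + 1) * norm (b N / real N)) sequentially"
      using eventually_ge_at_top[of "max 1 n0"]
    proof eventually_elim
      case (elim N)
      have "real N * v N \<le> C * (1 + S N + (T N)\<^sup>2)"
        using bound[of N] elim by (simp add: S_def T_def)
      also have "\<dots> \<le> C * (c * b N)" using b[of N] elim C by (intro mult_left_mono) auto
      also have "\<dots> \<le> \<bar>C * c * b N\<bar>" by simp
      also have "\<dots> \<le> (\<bar>C * c\<bar> + 1) * \<bar>b N\<bar>" by (simp add: abs_mult algebra_simps)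
      finally show ?case using elim v0[of N] by (simp add: field_simps)
    qed
  qed simp
  show "v \<in> O(\<lambda>N. 1 / real N)" if "\<alpha> > 1/2"
  proof (rule main)
    fix N :: nat assume "N \<ge> 0"
    \<comment> \<open>Both exponents exceed 1, so both series converge.\<close>
    have "S N \<le> (\<Sum>n. real n powr (- (2 * \<alpha>)))" unfolding S_def
      using that by (intro sum_powr_bounded) auto
    moreover have "(T N)\<^sup>2 \<le> (\<Sum>n. real n powr (- (\<alpha> + 1/2)))\<^sup>2"
      using that T0[of N] unfolding T_def by (intro power_mono sum_powr_bounded) auto
    ultimately show "1 + S N + (T N)\<^sup>2 \<le>
        (1 + (\<Sum>n. real n powr (- (2 * \<alpha>))) + (\<Sum>n. real n powr (- (\<alpha> + 1/2)))\<^sup>2) * 1"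
      by simp
  qed
  show "v \<in> O(\<lambda>N. (ln (real N))\<^sup>2 / real N)" if "\<alpha> = 1/2"
  proof (rule main)
    \<comment> \<open>Both exponents are 1, and \<open>N \<ge> 3\<close> gives
      \<open>ln N \<ge> 1\<close>, so that lower powers of the logarithm are absorbed into its
      square.\<close>
    fix N :: nat assume N: "N \<ge> 3"
    define l where "l = ln (real N)"
    have "exp 1 \<le> real N" using N exp_le by (meson of_nat_mono order_trans of_nat_numeral numeral_le_real_of_nat_iff)
    then have l: "1 \<le> l" unfolding l_def using N by (subst ln_ge_iff) auto
    have "1 + S N + (T N)\<^sup>2 \<le> 1 + (1 + l) + (1 + l)\<^sup>2"
      using sum_inverse_le_ln[of N] N T0[of N] unfolding S_def T_def l_def \<open>\<alpha> = 1/2\<close>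
      by (intro add_mono power_mono) auto
    also have "\<dots> \<le> 7 * l\<^sup>2"
    proof -
      have "l \<le> l\<^sup>2" "1 \<le> l\<^sup>2" using l by (auto simp: power2_eq_square intro: order_trans[OF l])
      then show ?thesis by (simp add: power2_eq_square algebra_simps)
    qed
    finally show "1 + S N + (T N)\<^sup>2 \<le> 7 * (ln (real N))\<^sup>2" by (simp add: l_def)
  qed
  show "v \<in> O(\<lambda>N. real N powr (- (2 * \<alpha>)))" if "\<alpha> < 1/2"
  proof -
    have "v \<in> O(\<lambda>N. real N powr (1 - 2 * \<alpha>) / real N)"
    proof (rule main)
      fix N :: nat assume N: "N \<ge> 1"
      define b where "b = real N powr (1 - 2 * \<alpha>)"
      have "1 \<le> b" unfolding b_def using N that by (intro ge_one_powr_ge_zero) auto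
      moreover have "S N \<le> b / (1 - 2 * \<alpha>)" unfolding S_def b_def
        using that \<alpha> by (intro sum_powr_le_powr) auto
      \<comment> \<open>The exponent \<open>1/2 - \<alpha>\<close> of the bound on
        \<open>T N\<close> doubles to \<open>1 - 2 * \<alpha>\<close>, the order of
        \<open>S N\<close>.\<close>
      moreover have "(T N)\<^sup>2 \<le> b / (1/2 - \<alpha>)\<^sup>2"
      proof -
        have "T N \<le> real N powr (1/2 - \<alpha>) / (1/2 - \<alpha>)"
          unfolding T_def using sum_powr_le_powr[of "\<alpha> + 1/2" N] that \<alpha> by simp
        then have "(T N)\<^sup>2 \<le> (real N powr (1/2 - \<alpha>) / (1/2 - \<alpha>))\<^sup>2"
          using T0 by (intro power_mono) auto
        moreover have "(real N powr (1/2 - \<alpha>))\<^sup>2 = b"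
          by (simp add: b_def power2_eq_square flip: powr_add)
        ultimately show ?thesis by (simp add: power_divide)
      qed
      ultimately show "1 + S N + (T N)\<^sup>2 \<le> (1 + 1 / (1 - 2 * \<alpha>) + 1 / (1/2 - \<alpha>)\<^sup>2) * b"
        by (simp add: algebra_simps)
    qed
    also have "(\<lambda>N. real N powr (1 - 2 * \<alpha>) / real N) \<in> O(\<lambda>N. real N powr (- (2 * \<alpha>)))"
      by (intro landau_o.bigI[of 1] eventually_mono[OF eventually_gt_at_top[of 0]])
        (auto simp: powr_diff powr_minus divide_inverse)
    finally show ?thesis .
  qed
qed

section \<open>Ergodic averages and saddle points\<close>

lemma ergodic_mean_convex:
  assumes "convex C" "N \<ge> 1" "\<And>n. n \<ge> 1 \<Longrightarrow> x n \<in> C"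
  shows "ergodic_mean x N \<in> C"
proof -
  have "(\<Sum>n=1..N. (1 / real N) *\<^sub>R x n) \<in> C"
    using assms by (intro convex_sum) auto
  then show ?thesis by (simp add: ergodic_mean_def scaleR_sum_right)
qed

lemma ergodic_mean_Jensen:
  assumes "convex_on C \<phi>" "N \<ge> 1" "\<And>n. n \<ge> 1 \<Longrightarrow> x n \<in> C"
  shows "real N * \<phi> (ergodic_mean x N) \<le> (\<Sum>n=1..N. \<phi> (x n))"
proof -
  have "\<phi> (\<Sum>n=1..N. (1 / real N) *\<^sub>R x n) \<le> (\<Sum>n=1..N. 1 / real N * \<phi> (x n))"
    using assms by (intro convex_on_sum) auto
  then have "\<phi> (ergodic_mean x N) \<le> (\<Sum>n=1..N. \<phi> (x n)) / real N"
    by (simp add: ergodic_mean_def scaleR_sum_right sum_divide_distrib)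
  then show ?thesis using assms(2) by (simp add: le_divide_eq mult.commute)
qed

lemma sum_ergodic_mean: "N \<ge> 1 \<Longrightarrow> (\<Sum>n=1..N. x n) = real N *\<^sub>R ergodic_mean x N"
  by (simp add: ergodic_mean_def)

lemma Lagr_real:
  assumes "proper_fun f" "proper_fun g" "proper_fun (conjugate h)"
    and "x \<in> edom f" "x \<in> edom g" "y \<in> edom (conjugate h)"
  shows "Lagr K f g h x y = ereal (K x \<bullet> y + real_of_ereal (f x) + real_of_ereal (g x)
    - real_of_ereal (conjugate h y))"
  using ereal_real_edom[OF assms(1,4)] ereal_real_edom[OF assms(2,5)] ereal_real_edom[OF assms(3,6)]
  by (metis Lagr_def ereal_minus(1) plus_ereal.simps(1))

text \<open>The values at \<open>(xs, v)\<close> and \<open>(u, ys)\<close>, with \<open>u\<close>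
  and \<open>v\<close> in the domains, are compared directly; this avoids
  \<open>\<infinity> - \<infinity>\<close>, which the value at \<open>(xs, ys)\<close> might
  involve.\<close>

lemma saddle_point_edom:
  assumes f: "proper_fun f" "edom f = UNIV" and g: "proper_fun g" and h: "proper_fun (conjugate h)"
    and saddle: "saddle_point K f g h xs ys"
  shows "xs \<in> edom g" "ys \<in> edom (conjugate h)"
proof -
  obtain u v where u: "u \<in> edom g" and v: "v \<in> edom (conjugate h)"
    using proper_edom[OF g] proper_edom[OF h] by blast
  have "Lagr K f g h xs v \<le> Lagr K f g h xs ys" "Lagr K f g h xs ys \<le> Lagr K f g h u ys"
    using saddle by (auto simp: saddle_point_def)
  then have le: "Lagr K f g h xs v \<le> Lagr K f g h u ys" by (rule order_trans)
  have "xs \<in> edom f" "u \<in> edom f" using f(2) by auto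
  then obtain a b c d where "f xs = ereal a" "f u = ereal b" "g u = ereal c" "conjugate h v = ereal d"
    using ereal_real_edom[OF f(1)] ereal_real_edom[OF g u] ereal_real_edom[OF h v] by metis
  moreover have "g xs \<noteq> -\<infinity>" "conjugate h ys \<noteq> -\<infinity>"
    using g h by (auto simp: proper_fun_def)
  ultimately show "xs \<in> edom g" "ys \<in> edom (conjugate h)"
    using le by (cases "g xs"; cases "conjugate h ys"; simp add: Lagr_def edom_def)+
qed

theorem corollary3p4:
  fixes K :: "'x::{real_inner,complete_space} \<Rightarrow> 'y::{real_inner,complete_space}"
    and f g :: "'x \<Rightarrow> ereal" and h :: "'y \<Rightarrow> ereal"
    and L Lf \<beta> \<tau> \<sigma> \<alpha> :: real and i :: nat
    and \<epsilon> \<delta> :: "nat \<Rightarrow> real" and e :: "nat \<Rightarrow> 'x"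
    and x :: "nat \<Rightarrow> 'x" and y :: "nat \<Rightarrow> 'y"
    and xs :: 'x and ys :: 'y
  assumes K: "bounded_linear K"
    and f: "pcl_fun f"
    and f_diff: "\<And>u. u \<in> edom f \<Longrightarrow> ediff_at f u"
    and f_lip: "\<And>u v. u \<in> edom f \<Longrightarrow> v \<in> edom f \<Longrightarrow>
                  norm (grad f u - grad f v) \<le> Lf * norm (u - v)"
    and g: "pcl_fun g"
    and h: "pcl_fun h"
    and L: "L = onorm K"
    and pos: "\<beta> > 0" "\<tau> > 0" "\<sigma> > 0"
    and step: "\<tau> * Lf + \<sigma> * \<tau> * L\<^sup>2 + \<tau> * \<beta> * L < 1"
    and i: "i \<in> {1, 2, 3}"
    and err_nonneg: "\<And>n. n \<ge> 1 \<Longrightarrow> \<epsilon> n \<ge> 0" "\<And>n. n \<ge> 1 \<Longrightarrow> \<delta> n \<ge> 0"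
    and iter: "inexact_pd_iteration K f g h \<tau> \<sigma> i \<epsilon> \<delta> e x y"
    and \<alpha>: "\<alpha> > 0"
    and e_rate: "(\<lambda>n. norm (e n)) \<in> O(\<lambda>n. real n powr (- (\<alpha> + 1/2)))"
    and \<delta>_rate: "\<delta> \<in> O(\<lambda>n. real n powr (- (2 * \<alpha>)))"
    and \<epsilon>_rate13: "i \<in> {1, 3} \<Longrightarrow> \<epsilon> \<in> O(\<lambda>n. real n powr (- (2 * \<alpha> + 1)))"
    and \<epsilon>_rate2: "i = 2 \<Longrightarrow> \<epsilon> \<in> O(\<lambda>n. real n powr (- (2 * \<alpha>)))"
    and saddle: "saddle_point K f g h xs ys"
  shows "\<exists>gap :: nat \<Rightarrow> real.
           (\<forall>N\<ge>1. Lagr K f g h (ergodic_mean x N) ys - Lagr K f g h xs (ergodic_mean y N)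
                     = ereal (gap N)) \<and>
           (\<alpha> > 1/2 \<longrightarrow> gap \<in> O(\<lambda>N. 1 / real N)) \<and>
           (\<alpha> = 1/2 \<longrightarrow> gap \<in> O(\<lambda>N. (ln (real N))\<^sup>2 / real N)) \<and>
           (\<alpha> < 1/2 \<longrightarrow> gap \<in> O(\<lambda>N. real N powr (- (2 * \<alpha>))))"
proof -

  \<comment> \<open>Domains and finiteness\<close>
  interpret K: bounded_linear K by (rule K)
  have f': "proper_fun f" "convex_fun f" and g': "proper_fun g" "convex_fun g"
    using f g by (auto simp: pcl_fun_def)
  have h': "proper_fun (conjugate h)" "convex_fun (conjugate h)"
    using h proper_conjugate convex_conjugate by (auto simp: pcl_fun_def)
  \<comment> \<open>The starting point \<open>x 0\<close> is arbitrary, so the gradient of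
    \<open>f\<close> must be available everywhere.\<close>
  have dom_f: "edom f = UNIV" by (rule edom_eq_UNIV[OF f f_diff f_lip])
  note f_diff = f_diff[unfolded dom_f, OF UNIV_I] and f_lip = f_lip[unfolded dom_f, OF UNIV_I UNIV_I]
  note star = saddle_point_edom[OF f'(1) dom_f g'(1) h'(1) saddle]
  have prox_y: "approx_prox2 (\<delta> (Suc n)) \<sigma> (conjugate h)
      (y n + \<sigma> *\<^sub>R K (2 *\<^sub>R x n - x (n - 1))) (y (Suc n))"
    and prox_x: "approx_prox i (\<epsilon> (Suc n)) \<tau> g
      (x n - \<tau> *\<^sub>R (adjoint K (y (Suc n)) + grad f (x n) + e (Suc n))) (x (Suc n))" for n
    using iter by (auto simp: inexact_pd_iteration_def)
  have x_dom: "x n \<in> edom g" and y_dom: "y n \<in> edom (conjugate h)" if "n \<ge> 1" for n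
    using approx_prox_edom[OF g'(1) prox_x[of "n - 1"]] approx_prox2_edom[OF h'(1) prox_y[of "n - 1"]] that
    by auto

  \<comment> \<open>The Lagrangian as a real-valued function\<close>
  define F where "F u = real_of_ereal (f u)" for u
  define G where "G u = real_of_ereal (g u)" for u
  define H where "H v = real_of_ereal (conjugate h v)" for v
  define \<Lambda> where "\<Lambda> u v = K u \<bullet> v + F u + G u - H v" for u v
  have F: "convex_on UNIV F" and G: "convex_on (edom g) G" and H: "convex_on (edom (conjugate h)) H"
    using convex_on_edom[OF f'] convex_on_edom[OF g'] convex_on_edom[OF h']
    by (simp_all add: F_def[abs_def] G_def[abs_def] H_def[abs_def] dom_f)
  have Lagr_\<Lambda>: "Lagr K f g h u v = ereal (\<Lambda> u v)" if "u \<in> edom g" "v \<in> edom (conjugate h)" for u v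
    using Lagr_real[OF f'(1) g'(1) h'(1)] that dom_f by (simp add: \<Lambda>_def F_def G_def H_def)
  have gap_nonneg: "\<Lambda> xs v \<le> \<Lambda> u ys" if "u \<in> edom g" "v \<in> edom (conjugate h)" for u v
  proof -
    have "Lagr K f g h xs v \<le> Lagr K f g h u ys"
      using saddle by (auto simp: saddle_point_def intro: order_trans)
    then show ?thesis using Lagr_\<Lambda> that star by simp
  qed

  \<comment> \<open>Energy along the iteration\<close>
  define a where "a n = norm (x n - xs)" for n
  define \<rho> where "\<rho> n = (if i = 2 then 0 else sqrt (2 * \<epsilon> n / \<tau>))" for n
  define E where "E n = norm (e n) + \<rho> n" for n
  define V where "V n = pd_energy K \<tau> \<sigma> xs ys (x n) (y n) (x (n - 1))" for n
  have V_lower: "(a n)\<^sup>2 / (2 * \<tau>) \<le> V n" for n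
    unfolding V_def a_def by (rule pd_energy_lower[OF K pos(3)])
  have V_nonneg: "0 \<le> V n" for n
    by (rule order_trans[OF _ V_lower]) (use pos in simp)
  have "\<tau> * \<beta> * L \<ge> 0" using pos onorm_pos_le[OF K] L by simp
  then have step': "\<tau> * Lf + \<sigma> * \<tau> * (onorm K)\<^sup>2 \<le> 1" using step L by simp
  have one_step: "\<Lambda> (x (Suc n)) ys - \<Lambda> xs (y (Suc n))
      \<le> V n - V (Suc n) + E (Suc n) * a (Suc n) + (\<epsilon> (Suc n) + \<delta> (Suc n))" for n
  proof -
    have "F (x n) + grad f (x n) \<bullet> (xs - x n) \<le> F xs"
      unfolding F_def by (rule convex_above_tangent[OF f' f_diff]) (simp add: dom_f)
    moreover have "F (x (Suc n)) \<le> F (x n) + grad f (x n) \<bullet> (x (Suc n) - x n)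
        + Lf / 2 * (norm (x (Suc n) - x n))\<^sup>2"
      unfolding F_def by (rule descent_lemma[OF f_diff f_lip])
    moreover note approx_prox_ineq[OF g' prox_x star(1) pos(2) err_nonneg(1), of n, folded G_def \<rho>_def]
    moreover note approx_prox2_ineq[OF h'(1) prox_y star(2), of n, folded H_def]
    ultimately show ?thesis
      using pd_energy_step[OF K pos(2,3) step' adjoint_Hilbert[OF K]]
      by (simp add: \<Lambda>_def E_def a_def V_def)
  qed
  \<comment> \<open>The one-step estimates telescope.\<close>
  have energy: "(\<Sum>n=1..N. \<Lambda> (x n) ys - \<Lambda> xs (y n)) + V N
      \<le> V 0 + (\<Sum>n=1..N. E n * a n + (\<epsilon> n + \<delta> n))" for N
  proof (induction N)
    case (Suc N)
    then show ?case using one_step[of N] by simp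
  qed simp

  \<comment> \<open>Accumulated errors\<close>
  have \<rho>0: "0 \<le> \<rho> n" if "n \<ge> 1" for n using err_nonneg(1)[OF that] pos by (simp add: \<rho>_def)
  have E0: "0 \<le> E n" if "n \<ge> 1" for n using \<rho>0[OF that] by (simp add: E_def)
  \<comment> \<open>Here \<open>p = 1 / (2 * \<tau>)\<close> is the factor in the lower bound on the
    energy; the quadratic inequality follows from \<open>energy\<close> because the gaps are
    nonnegative.\<close>
  have err: "(\<Sum>n=1..N. E n * a n) \<le> V 0 + (\<Sum>n=1..N. \<epsilon> n + \<delta> n) + (\<Sum>n=1..N. E n)\<^sup>2 / (1 / (2 * \<tau>))" for N
  proof (rule error_sum_bound)
    fix N
    have "0 \<le> (\<Sum>n=1..N. \<Lambda> (x n) ys - \<Lambda> xs (y n))"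
      using gap_nonneg x_dom y_dom by (intro sum_nonneg) simp
    then show "1 / (2 * \<tau>) * (a N)\<^sup>2 \<le> V 0 + (\<Sum>n=1..N. E n * a n + (\<epsilon> n + \<delta> n))"
      using energy[of N] V_lower[of N] by simp
  qed (use E0 err_nonneg pos in \<open>auto simp: a_def\<close>)

  \<comment> \<open>The gap at the ergodic means\<close>
  define gap where "gap N = \<Lambda> (ergodic_mean x N) ys - \<Lambda> xs (ergodic_mean y N)" for N
  have mean_dom: "ergodic_mean x N \<in> edom g" "ergodic_mean y N \<in> edom (conjugate h)" if "N \<ge> 1" for N
    using ergodic_mean_convex[OF convex_on_imp_convex[OF G] that x_dom]
      ergodic_mean_convex[OF convex_on_imp_convex[OF H] that y_dom] by auto
  have gap_sum: "real N * gap N \<le> (\<Sum>n=1..N. \<Lambda> (x n) ys - \<Lambda> xs (y n))" if N: "N \<ge> 1" for N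
  proof -
    have "(\<Sum>n=1..N. K (x n) \<bullet> ys) = real N * (K (ergodic_mean x N) \<bullet> ys)"
      using sum_ergodic_mean[OF N, of x] by (simp flip: inner_sum_left K.sum add: K.scaleR)
    moreover have "(\<Sum>n=1..N. K xs \<bullet> y n) = real N * (K xs \<bullet> ergodic_mean y N)"
      using sum_ergodic_mean[OF N, of y] by (simp flip: inner_sum_right)
    moreover note ergodic_mean_Jensen[OF F N, of x] ergodic_mean_Jensen[OF G N, of x, OF x_dom]
      ergodic_mean_Jensen[OF H N, of y, OF y_dom]
    ultimately show ?thesis
      by (simp add: gap_def \<Lambda>_def sum.distrib sum_subtractf algebra_simps)
  qed

  \<comment> \<open>Decay of the errors\<close>
  have "\<exists>CE Cs. CE \<ge> 0 \<and> Cs \<ge> 0 \<and> (\<forall>n\<ge>1. \<rho> n \<le> CE * real n powr (- (\<alpha> + 1/2)) \<and> \<epsilon> n \<le> Cs * real n powr (- (2 * \<alpha>)))"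
  proof (cases "i = 2")
    case True
    obtain C where "C \<ge> 0" "\<And>n. n \<ge> 1 \<Longrightarrow> \<bar>\<epsilon> n\<bar> \<le> C * real n powr (- (2 * \<alpha>))"
      using bigo_powr_bound[OF \<epsilon>_rate2[OF True]] by blast
    then show ?thesis using True
      by (intro exI[of _ 0] exI[of _ C]) (auto simp: \<rho>_def intro: order_trans[OF abs_ge_self])
  next
    case False
    then have "\<epsilon> \<in> O(\<lambda>n. real n powr (- (2 * \<alpha> + 1)))" using i \<epsilon>_rate13 by auto
    then obtain C where C: "C \<ge> 0" "\<And>n. n \<ge> 1 \<Longrightarrow> \<bar>\<epsilon> n\<bar> \<le> C * real n powr (- (2 * \<alpha> + 1))"
      using bigo_powr_bound by blast
    have "\<rho> n \<le> sqrt (2 * C / \<tau>) * real n powr (- (\<alpha> + 1/2))" if "n \<ge> 1" for n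
    proof -
      have "2 * \<epsilon> n / \<tau> \<le> 2 * C / \<tau> * real n powr (- (2 * \<alpha> + 1))"
        using C(2)[OF that] pos by (simp add: divide_le_cancel)
      \<comment> \<open>The square root in \<open>\<rho>\<close> halves the exponent, which explains
        the faster decay of \<open>\<epsilon>\<close> asked for types 1 and 3.\<close>
      also have "real n powr (- (2 * \<alpha> + 1)) = (real n powr (- (\<alpha> + 1/2)))\<^sup>2"
        by (simp add: power2_eq_square flip: powr_add)
      finally have "sqrt (2 * \<epsilon> n / \<tau>) \<le> sqrt (2 * C / \<tau> * (real n powr (- (\<alpha> + 1/2)))\<^sup>2)"
        by (rule real_sqrt_le_mono)
      also have "\<dots> = sqrt (2 * C / \<tau>) * real n powr (- (\<alpha> + 1/2))"
        by (simp only: real_sqrt_mult real_sqrt_abs abs_of_nonneg powr_ge_zero)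
      finally show ?thesis using False by (simp add: \<rho>_def)
    qed
    moreover have "\<epsilon> n \<le> C * real n powr (- (2 * \<alpha>))" if "n \<ge> 1" for n
    proof -
      have "C * real n powr (- (2 * \<alpha> + 1)) \<le> C * real n powr (- (2 * \<alpha>))"
        using C that by (intro mult_left_mono powr_mono) auto
      then show ?thesis using C(2)[OF that] by simp
    qed
    ultimately show ?thesis using C(1) pos
      by (intro exI[of _ "sqrt (2 * C / \<tau>)"] exI[of _ C]) auto
  qed
  then obtain C1 C2 where C12: "C1 \<ge> 0" "C2 \<ge> 0"
    "\<And>n. n \<ge> 1 \<Longrightarrow> \<rho> n \<le> C1 * real n powr (- (\<alpha> + 1/2))"
    "\<And>n. n \<ge> 1 \<Longrightarrow> \<epsilon> n \<le> C2 * real n powr (- (2 * \<alpha>))" by blast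
  obtain C3 where C3: "C3 \<ge> 0" "\<And>n. n \<ge> 1 \<Longrightarrow> norm (e n) \<le> C3 * real n powr (- (\<alpha> + 1/2))"
    using bigo_powr_bound[OF e_rate] by auto
  obtain C4 where C4: "C4 \<ge> 0" "\<And>n. n \<ge> 1 \<Longrightarrow> \<bar>\<delta> n\<bar> \<le> C4 * real n powr (- (2 * \<alpha>))"
    using bigo_powr_bound[OF \<delta>_rate] by auto

  \<comment> \<open>Assembling the bound\<close>
  define C where "C = 2 * V 0 + 2 * (C2 + C4) + 2 * \<tau> * (C3 + C1)\<^sup>2"
  have C0: "C \<ge> 0" using V_nonneg[of 0] C12 C4 pos by (simp add: C_def)
  have bound: "real N * gap N \<le> C * (1 + (\<Sum>n=1..N. real n powr (- (2 * \<alpha>)))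
      + (\<Sum>n=1..N. real n powr (- (\<alpha> + 1/2)))\<^sup>2)" if N: "N \<ge> 1" for N
  proof -
    define S where "S = (\<Sum>n=1..N. real n powr (- (2 * \<alpha>)))"
    define T where "T = (\<Sum>n=1..N. real n powr (- (\<alpha> + 1/2)))"
    have S0: "0 \<le> S" unfolding S_def by (intro sum_nonneg) simp
    have "real N * gap N \<le> V 0 + (\<Sum>n=1..N. E n * a n) + (\<Sum>n=1..N. \<epsilon> n + \<delta> n)"
      using gap_sum[OF N] energy[of N] V_nonneg[of N] by (simp add: sum.distrib)
    \<comment> \<open>The factors 2 arise because \<open>V 0\<close> and the sum of
      \<open>\<epsilon> n + \<delta> n\<close> enter once through \<open>energy\<close> and once
      through \<open>err\<close>.\<close>
    also have "\<dots> \<le> 2 * V 0 + 2 * (\<Sum>n=1..N. \<epsilon> n + \<delta> n) + 2 * \<tau> * (\<Sum>n=1..N. E n)\<^sup>2"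
      using err[of N] by (simp add: mult.commute)
    also have "\<dots> \<le> 2 * V 0 + 2 * ((C2 + C4) * S) + 2 * \<tau> * ((C3 + C1) * T)\<^sup>2"
    proof (intro add_mono mult_left_mono power_mono)
      show "(\<Sum>n=1..N. \<epsilon> n + \<delta> n) \<le> (C2 + C4) * S"
        unfolding S_def sum_distrib_left
        using C12(4) C4(2) by (intro sum_mono) (force simp: distrib_right intro: add_mono)
      show "(\<Sum>n=1..N. E n) \<le> (C3 + C1) * T"
        unfolding T_def sum_distrib_left E_def
        using C12(3) C3(2) by (intro sum_mono) (force simp: distrib_right intro: add_mono)
      show "0 \<le> (\<Sum>n=1..N. E n)" using E0 by (intro sum_nonneg) simp
    qed (use pos in auto)
    also have "\<dots> \<le> C * 1 + C * S + C * T\<^sup>2"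
    proof -
      have "2 * V 0 \<le> C" "2 * (C2 + C4) \<le> C" "2 * \<tau> * (C3 + C1)\<^sup>2 \<le> C"
        using V_nonneg[of 0] C12 C4 pos by (auto simp: C_def)
      moreover from this(2) have "2 * (C2 + C4) * S \<le> C * S"
        using S0 by (rule mult_right_mono)
      moreover from calculation(3) have "2 * \<tau> * (C3 + C1)\<^sup>2 * T\<^sup>2 \<le> C * T\<^sup>2"
        by (rule mult_right_mono) simp
      ultimately show ?thesis
        unfolding power_mult_distrib mult.assoc mult_1_right by linarith
    qed
    finally show ?thesis by (simp add: S_def T_def distrib_left)
  qed
  have nonneg: "0 \<le> gap N" if "N \<ge> 1" for N
    using gap_nonneg[OF mean_dom[OF that]] by (simp add: gap_def)
  show ?thesis
  proof (intro exI[of _ gap] conjI allI impI)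
    fix N :: nat assume "N \<ge> 1"
    then show "Lagr K f g h (ergodic_mean x N) ys - Lagr K f g h xs (ergodic_mean y N) = ereal (gap N)"
      using mean_dom star by (simp add: Lagr_\<Lambda> gap_def)
  qed (use ergodic_rate[OF \<alpha> nonneg bound C0] in auto)
qed

end
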